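(* For every $n\ge 4$, there exists a non-homotopic $n$-vertex connected quasiplanar graph with exactly $8n-20$ edges.
   Context: Graphs are finite and have no loops, but may have parallel edges. A drawing on the sphere $\mathbb{S}^2$ maps vertices to pairwise distinct points and each edge to a simple Jordan arc joining its endpoints, such that no edge passes through a vertex, any two edges have finitely many common points, every common interior point of two edges is a proper crossing, and no three edges pass through the same crossing. A drawing is quasiplanar if no three edges pairwise cross. A lens is a region bounded by a simple closed curve consisting of exactly two contiguous parts, each being (a part of) a single edge (e.g. two uncrossed parallel edges, parts of two adjacent edges that cross, or parts of two edges crossing more than once); a drawing is non-homotopic if every lens contains a vertex or a crossing in its interior. A non-homotopic quasiplanar graph is a graph admitting a drawing that is both non-homotopic and quasiplanar. *)

theory Defs
  imports "HOL-Analysis.Analysis"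
begin

text \<open>The sphere S^2, realised as the unit sphere in R^3.\<close>
definition S2 :: "(real^3) set" where
  "S2 = sphere 0 1"

text \<open>A finite multigraph without loops: vertex set V, edge index set E,
  and an endpoint map ends (parallel edges allowed).\<close>
definition multigraph :: "'v set \<Rightarrow> 'e set \<Rightarrow> ('e \<Rightarrow> 'v \<times> 'v) \<Rightarrow> bool" where
  "multigraph V E ends \<longleftrightarrow> finite V \<and> finite E \<and>
     (\<forall>e\<in>E. fst (ends e) \<in> V \<and> snd (ends e) \<in> V \<and> fst (ends e) \<noteq> snd (ends e))"

definition mg_adj :: "'e set \<Rightarrow> ('e \<Rightarrow> 'v \<times> 'v) \<Rightarrow> ('v \<times> 'v) set" where
  "mg_adj E ends = {(u, v). \<exists>e\<in>E. ends e = (u, v) \<or> ends e = (v, u)}"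

definition mg_connected :: "'v set \<Rightarrow> 'e set \<Rightarrow> ('e \<Rightarrow> 'v \<times> 'v) \<Rightarrow> bool" where
  "mg_connected V E ends \<longleftrightarrow> (\<forall>u\<in>V. \<forall>v\<in>V. (u, v) \<in> (mg_adj E ends)\<^sup>*)"

text \<open>Interior points of a drawn edge.\<close>
definition arc_interior :: "(real \<Rightarrow> real^3) \<Rightarrow> (real^3) set" where
  "arc_interior g = g ` {0<..<1}"

text \<open>p is a proper crossing of the arcs g and h: locally around p the pair
  looks like the two coordinate axes in an open disc.\<close>
definition proper_crossing :: "(real \<Rightarrow> real^3) \<Rightarrow> (real \<Rightarrow> real^3) \<Rightarrow> real^3 \<Rightarrow> bool" where
  "proper_crossing g h p \<longleftrightarrow>
     (\<exists>U (\<phi> :: real^3 \<Rightarrow> real^2) \<psi>. openin (top_of_set S2) U \<and> p \<in> U \<and>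
        homeomorphism U (ball 0 1) \<phi> \<psi> \<and> \<phi> p = 0 \<and>
        \<phi> ` (path_image g \<inter> U) = {x \<in> ball 0 1. x $ 2 = 0} \<and>
        \<phi> ` (path_image h \<inter> U) = {x \<in> ball 0 1. x $ 1 = 0})"

text \<open>A drawing of the multigraph on the sphere: pos places vertices, \<gamma> draws edges.\<close>
definition drawing :: "'v set \<Rightarrow> 'e set \<Rightarrow> ('e \<Rightarrow> 'v \<times> 'v) \<Rightarrow> ('v \<Rightarrow> real^3)
    \<Rightarrow> ('e \<Rightarrow> real \<Rightarrow> real^3) \<Rightarrow> bool" where
  "drawing V E ends pos \<gamma> \<longleftrightarrow>
     pos ` V \<subseteq> S2 \<and> inj_on pos V \<and>
     (\<forall>e\<in>E. arc (\<gamma> e) \<and> path_image (\<gamma> e) \<subseteq> S2 \<and>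
        pathstart (\<gamma> e) = pos (fst (ends e)) \<and> pathfinish (\<gamma> e) = pos (snd (ends e))) \<and>
     (\<forall>e\<in>E. arc_interior (\<gamma> e) \<inter> pos ` V = {}) \<and>
     (\<forall>e\<in>E. \<forall>f\<in>E. e \<noteq> f \<longrightarrow> finite (path_image (\<gamma> e) \<inter> path_image (\<gamma> f))) \<and>
     (\<forall>e\<in>E. \<forall>f\<in>E. e \<noteq> f \<longrightarrow>
        (\<forall>p \<in> arc_interior (\<gamma> e) \<inter> arc_interior (\<gamma> f). proper_crossing (\<gamma> e) (\<gamma> f) p)) \<and>
     (\<forall>e\<in>E. \<forall>f\<in>E. \<forall>g\<in>E. e \<noteq> f \<and> e \<noteq> g \<and> f \<noteq> g \<longrightarrow>
        arc_interior (\<gamma> e) \<inter> arc_interior (\<gamma> f) \<inter> arc_interior (\<gamma> g) = {})"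

definition edges_cross :: "('e \<Rightarrow> real \<Rightarrow> real^3) \<Rightarrow> 'e \<Rightarrow> 'e \<Rightarrow> bool" where
  "edges_cross \<gamma> e f \<longleftrightarrow> e \<noteq> f \<and> arc_interior (\<gamma> e) \<inter> arc_interior (\<gamma> f) \<noteq> {}"

definition crossings :: "'e set \<Rightarrow> ('e \<Rightarrow> real \<Rightarrow> real^3) \<Rightarrow> (real^3) set" where
  "crossings E \<gamma> = {p. \<exists>e\<in>E. \<exists>f\<in>E. e \<noteq> f \<and> p \<in> arc_interior (\<gamma> e) \<inter> arc_interior (\<gamma> f)}"

definition quasiplanar_drawing :: "'e set \<Rightarrow> ('e \<Rightarrow> real \<Rightarrow> real^3) \<Rightarrow> bool" where
  "quasiplanar_drawing E \<gamma> \<longleftrightarrow>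
     \<not> (\<exists>e\<in>E. \<exists>f\<in>E. \<exists>g\<in>E. edges_cross \<gamma> e f \<and> edges_cross \<gamma> f g \<and> edges_cross \<gamma> e g)"

text \<open>Non-homotopic: whenever a part alpha of edge e and a part beta of edge f
  have the same two endpoints and meet only there (so together they form a simple
  closed curve), every region bounded by that curve (every component of its
  complement in the sphere) contains a vertex or a crossing.\<close>
definition nonhomotopic_drawing :: "'v set \<Rightarrow> 'e set \<Rightarrow> ('v \<Rightarrow> real^3)
    \<Rightarrow> ('e \<Rightarrow> real \<Rightarrow> real^3) \<Rightarrow> bool" where
  "nonhomotopic_drawing V E pos \<gamma> \<longleftrightarrow>
     (\<forall>e\<in>E. \<forall>f\<in>E. \<forall>a b c d :: real.
        0 \<le> a \<and> a < b \<and> b \<le> 1 \<and> 0 \<le> c \<and> c < d \<and> d \<le> 1 \<longrightarrow>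
        (let \<alpha> = subpath a b (\<gamma> e); \<beta> = subpath c d (\<gamma> f) in
          {pathstart \<alpha>, pathfinish \<alpha>} = {pathstart \<beta>, pathfinish \<beta>} \<and>
          path_image \<alpha> \<inter> path_image \<beta> = {pathstart \<alpha>, pathfinish \<alpha>} \<longrightarrow>
          (\<forall>R \<in> components (S2 - (path_image \<alpha> \<union> path_image \<beta>)).
             (\<exists>v\<in>V. pos v \<in> R) \<or> R \<inter> crossings E \<gamma> \<noteq> {})))"

end

theory Submission
  imports Defs
begin

text \<open>
  Put the vertices \<open>0, \<dots>, n - 1\<close> on the equator in this cyclic order. Draw a maximal set of
  \<open>4n - 10\<close> chords without three pairwise crossing ones as vertical circular arcs in the upper hemisphere,
  and the same set without its \<open>n\<close> cycle edges in the lower hemisphere. The missing \<open>n\<close> edges are woven: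
  the \<open>i\<close>-th one runs above from vertex \<open>i\<close> to a point of the equator between \<open>i + 1\<close> and \<open>i + 2\<close>, and then
  below to vertex \<open>i + 3\<close>. Above, it crosses only edges at \<open>i + 1\<close> and its two neighbouring
  woven edges; below, only edges at \<open>i + 2\<close> and these neighbours; hence no three edges pairwise cross.

  Under vertical projection every edge is a chord of the unit disc in each hemisphere. In the disc, no
  region cut out by two chords avoids the boundary circle, so every region of a lens reaches a
  point \<open>y\<close> of the equator that lies on no edge. A vertex on the boundary of a lens is an end of both edges,
  which makes it possible to join \<open>y\<close> to a vertex off the boundary by a further chord, above or below,
  that meets neither edge. So every such region contains a vertex, and the Jordan curve theorem is not needed.
\<close>

subsection \<open>Chords of the unit circle\<close>

text \<open>Rational parametrisation of the unit circle; it misses only \<open>(-1, 0)\<close>.\<close>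
definition pt :: "real \<Rightarrow> real^2" where
  "pt t = vector [(1 - t\<^sup>2) / (1 + t\<^sup>2), 2 * t / (1 + t\<^sup>2)]"

text \<open>Twice the signed area of the triangle \<open>p\<close>, \<open>q\<close>,
  \<open>x\<close>: the sign tells on which side of the line through \<open>p\<close> and
  \<open>q\<close> the point \<open>x\<close> lies.\<close>

definition orient :: "real^2 \<Rightarrow> real^2 \<Rightarrow> real^2 \<Rightarrow> real" where
  "orient p q x = (q$1 - p$1) * (x$2 - p$2) - (q$2 - p$2) * (x$1 - p$1)"

text \<open>Strict separation of two pairs in the cyclic order. Spelling out all orders makes it
  symmetric in the ends of each chord; the polymorphic type serves natural positions as well as real
  parameters.\<close>

definition interleaved :: "'a::linorder \<Rightarrow> 'a \<Rightarrow> 'a \<Rightarrow> 'a \<Rightarrow> bool" where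
  "interleaved a b c d \<longleftrightarrow>
     (a < c \<and> c < b \<or> b < c \<and> c < a) \<and> (d < a \<and> d < b \<or> a < d \<and> b < d) \<or>
     (a < d \<and> d < b \<or> b < d \<and> d < a) \<and> (c < a \<and> c < b \<or> a < c \<and> b < c)"

text \<open>For \<open>s = 1\<close> and \<open>s = -1\<close>, this is the inverse of the vertical projection on the upper and the lower hemisphere.\<close>
definition hemi :: "real \<Rightarrow> real^2 \<Rightarrow> real^3" where
  "hemi s x = vector [x$1, x$2, s * sqrt (1 - (norm x)\<^sup>2)]"

definition shadow :: "real^3 \<Rightarrow> real^2" where
  "shadow z = vector [z$1, z$2]"

lemma norm_sq_2: "(norm (x :: real^2))\<^sup>2 = (x$1)\<^sup>2 + (x$2)\<^sup>2"
  unfolding power2_norm_eq_inner inner_vec_def sum_2 by (simp add: power2_eq_square)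

lemma norm_sq_3: "(norm (x :: real^3))\<^sup>2 = (x$1)\<^sup>2 + (x$2)\<^sup>2 + (x$3)\<^sup>2"
  unfolding power2_norm_eq_inner inner_vec_def sum_3 by (simp add: power2_eq_square)

lemma norm_pt [simp]: "norm (pt t) = 1"
proof -
  have "1 + t\<^sup>2 \<noteq> 0"
    by (smt (verit) zero_le_power2)
  then have "(norm (pt t))\<^sup>2 = 1"
    unfolding norm_sq_2 pt_def by (simp add: divide_simps) algebra
  then show ?thesis
    by (simp add: power2_eq_1_iff) (smt (verit) norm_ge_zero)
qed

text \<open>A Vandermonde product over a positive denominator, so sides of chords are read off from
  the order of the parameters.\<close>

lemma orient_pt:
  "orient (pt a) (pt b) (pt c) = 4 * (b - a) * (c - a) * (c - b) / ((1 + a\<^sup>2) * (1 + b\<^sup>2) * (1 + c\<^sup>2))"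
proof -
  have "1 + a\<^sup>2 \<noteq> 0" "1 + b\<^sup>2 \<noteq> 0" "1 + c\<^sup>2 \<noteq> 0"
    by (smt (verit) zero_le_power2)+
  then show ?thesis
    unfolding orient_def pt_def by (simp add: divide_simps) algebra
qed

lemma orient_pt_eq_0_iff: "orient (pt a) (pt b) (pt c) = 0 \<longleftrightarrow> a = b \<or> c = a \<or> c = b"
proof -
  have "1 + a\<^sup>2 \<noteq> 0" "1 + b\<^sup>2 \<noteq> 0" "1 + c\<^sup>2 \<noteq> 0"
    by (smt (verit) zero_le_power2)+
  then show ?thesis
    by (auto simp: orient_pt)
qed

lemma pt_eq_iff [simp]: "pt a = pt b \<longleftrightarrow> a = b"
proof
  assume eq: "pt a = pt b"
  define c where "c = max a b + 1"
  have "orient (pt a) (pt b) (pt c) = 0"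
    by (simp add: eq orient_def)
  then show "a = b"
    by (auto simp: orient_pt_eq_0_iff c_def)
qed simp

lemma orient_affine:
  "orient p q ((1 - u) *\<^sub>R x + u *\<^sub>R y) = (1 - u) * orient p q x + u * orient p q y"
  by (simp add: orient_def algebra_simps)

lemma orient_ends [simp]: "orient p q p = 0" "orient p q q = 0"
  by (simp_all add: orient_def)

lemma orient_segment: "x \<in> closed_segment p q \<Longrightarrow> orient p q x = 0"
  by (auto simp: closed_segment_def orient_affine)

lemma interleaved_iff_orient:
  assumes "a \<noteq> b"
  shows "interleaved a b c d \<longleftrightarrow> orient (pt a) (pt b) (pt c) * orient (pt a) (pt b) (pt d) < 0"
proof -
  have pos: "0 < 1 + t\<^sup>2" for t :: real
    by (smt (verit) zero_le_power2)
  \<comment> \<open>\<open>K\<close> collects the factors that are known to be positive;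
    \<open>b - a\<close> occurs squared, so the order of \<open>a\<close> and \<open>b\<close> does
    not matter.\<close>
  define K where "K = 16 * (b - a)\<^sup>2 / ((1 + a\<^sup>2)\<^sup>2 * (1 + b\<^sup>2)\<^sup>2 * (1 + c\<^sup>2) * (1 + d\<^sup>2))"
  have K: "0 < K"
    unfolding K_def using assms pos[of a] pos[of b] pos[of c] pos[of d]
    by (intro divide_pos_pos mult_pos_pos) auto
  have "4 * k * p * q / (A * B * C) * (4 * k * u * v / (A * B * D))
      = 16 * k\<^sup>2 / (A\<^sup>2 * B\<^sup>2 * C * D) * ((p * q) * (u * v))" for A B C D k p q u v :: real
    by (simp add: power2_eq_square mult_ac)
  then have "orient (pt a) (pt b) (pt c) * orient (pt a) (pt b) (pt d)
      = K * (((c - a) * (c - b)) * ((d - a) * (d - b)))"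
    unfolding orient_pt K_def by blast
  then have "orient (pt a) (pt b) (pt c) * orient (pt a) (pt b) (pt d) < 0
      \<longleftrightarrow> ((c - a) * (c - b)) * ((d - a) * (d - b)) < 0"
    using K by (simp add: mult_less_0_iff)
  then show ?thesis
    by (auto simp: interleaved_def mult_less_0_iff zero_less_mult_iff)
qed

text \<open>Strict convexity of the disc: a point strictly inside a chord is closer to the centre
  than one of its ends.\<close>

lemma segment_on_circle:
  assumes "x \<in> closed_segment (pt a) (pt b)" "norm x = 1"
  shows "x = pt a \<or> x = pt b"
proof (rule ccontr)
  assume "\<not> ?thesis"
  then have "x \<in> open_segment (pt a) (pt b)"
    using assms by (simp add: open_segment_def)
  then have "dist 0 x < dist 0 (pt a) \<or> dist 0 x < dist 0 (pt b)"
    by (rule dist_decreases_open_segment)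
  then show False
    using assms by simp
qed

lemma segment_in_disc: "x \<in> closed_segment (pt a) (pt b) \<Longrightarrow> norm x \<le> 1"
  using closed_segment_subset[of "pt a" "cball 0 1" "pt b"] by auto

text \<open>At affine parameter \<open>u\<close> on the line, the squared norm is 1 minus
  \<open>u * (1 - u)\<close> times the squared length of the chord, so lying in the disc forces
  \<open>u\<close> into the unit interval.\<close>

lemma disc_line_segment:
  assumes "norm x \<le> 1" "orient (pt a) (pt b) x = 0" "a \<noteq> b"
  shows "x \<in> closed_segment (pt a) (pt b)"
proof -
  define p q where "p = pt a" and "q = pt b"
  define v where "v = q - p"
  have "p \<noteq> q"
    using assms by (simp add: p_def q_def)
  then have N: "(v$1)\<^sup>2 + (v$2)\<^sup>2 > 0"
    by (metis norm_sq_2 v_def eq_iff_diff_eq_0 zero_less_norm_iff zero_less_power)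
  \<comment> \<open>The coefficient of the orthogonal projection of \<open>x - p\<close> onto
    \<open>v\<close>.\<close>
  define u where "u = (v$1 * (x$1 - p$1) + v$2 * (x$2 - p$2)) / ((v$1)\<^sup>2 + (v$2)\<^sup>2)"
  have o: "v$1 * (x$2 - p$2) = v$2 * (x$1 - p$1)"
    using assms by (simp add: orient_def v_def p_def q_def)
  have uN: "u * ((v$1)\<^sup>2 + (v$2)\<^sup>2) = v$1 * (x$1 - p$1) + v$2 * (x$2 - p$2)"
    using N by (simp add: u_def)
  have "(x$1 - p$1) * ((v$1)\<^sup>2 + (v$2)\<^sup>2) = u * v$1 * ((v$1)\<^sup>2 + (v$2)\<^sup>2)"
       "(x$2 - p$2) * ((v$1)\<^sup>2 + (v$2)\<^sup>2) = u * v$2 * ((v$1)\<^sup>2 + (v$2)\<^sup>2)"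
    using o uN by algebra+
  then have x: "x$1 = p$1 + u * v$1" "x$2 = p$2 + u * v$2"
    using N by auto
  have xq: "x = (1 - u) *\<^sub>R p + u *\<^sub>R q"
    by (simp add: vec_eq_iff forall_2 x v_def algebra_simps)
  have P: "(p$1)\<^sup>2 + (p$2)\<^sup>2 = 1" "(q$1)\<^sup>2 + (q$2)\<^sup>2 = 1"
    by (metis norm_pt norm_sq_2 one_power2 p_def q_def)+
  have "(norm x)\<^sup>2 \<le> 1"
    using assms by (simp add: power_le_one)
  moreover have "(norm x)\<^sup>2 = 1 - u * (1 - u) * ((v$1)\<^sup>2 + (v$2)\<^sup>2)"
    unfolding norm_sq_2 x v_def vector_minus_component using P by algebra
  ultimately have "0 \<le> u * (1 - u)"
    using N by (smt (verit) mult_neg_pos)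
  then have "0 \<le> u" "u \<le> 1"
    by (auto simp: zero_le_mult_iff)
  with xq show ?thesis
    unfolding p_def q_def closed_segment_def by blast
qed

text \<open>Along the second chord, \<open>orient (pt a) (pt b)\<close> is affine with end values of
  weakly equal sign. For \<open>c \<noteq> d\<close> they are not both zero, so it can vanish only
  at an end.\<close>

lemma segments_meet:
  assumes "x \<in> closed_segment (pt a) (pt b)" "x \<in> closed_segment (pt c) (pt d)"
    and "\<not> interleaved a b c d" "{a, b} \<noteq> {c, d}" "a \<noteq> b"
  shows "x = pt c \<or> x = pt d"
proof -
  obtain u where u: "0 \<le> u" "u \<le> 1" "x = (1 - u) *\<^sub>R pt c + u *\<^sub>R pt d"
    using assms by (auto simp: closed_segment_def)
  let ?L = "orient (pt a) (pt b)"
  have z: "(1 - u) * ?L (pt c) + u * ?L (pt d) = 0"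
    using orient_segment[OF assms(1)] by (simp add: u orient_affine)
  have sgn: "?L (pt c) * ?L (pt d) \<ge> 0"
    using assms interleaved_iff_orient[of a b c d] by simp
  show ?thesis
  proof (cases "c = d")
    case True
    then show ?thesis using u by (simp add: algebra_simps)
  next
    case False
    then have ne: "?L (pt c) \<noteq> 0 \<or> ?L (pt d) \<noteq> 0"
      using assms by (auto simp: orient_pt_eq_0_iff)
    have "u = 0 \<or> u = 1"
    proof (rule ccontr)
      assume "\<not> ?thesis"
      then have "0 < u" "0 < 1 - u"
        using u by auto
      then show False
        using z sgn ne
        by (smt (verit) mult_nonneg_nonneg mult_pos_pos zero_le_mult_iff mult_neg_pos mult_eq_0_iff mult_pos_neg)
    qed
    then show ?thesis
      using u by auto
  qed
qed

lemma interleaved_sym: "interleaved a b c d \<longleftrightarrow> interleaved c d a b"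
  by (auto simp: interleaved_def)

lemma hemi_component [simp]:
  "hemi s x $ 1 = x$1" "hemi s x $ 2 = x$2" "hemi s x $ 3 = s * sqrt (1 - (norm x)\<^sup>2)"
  by (simp_all add: hemi_def)

lemma shadow_component [simp]: "shadow z $ 1 = z$1" "shadow z $ 2 = z$2"
  by (simp_all add: shadow_def)

lemma shadow_hemi [simp]: "shadow (hemi s x) = x"
  by (simp add: vec_eq_iff forall_2)

subsection \<open>Vertical projection\<close>

lemma continuous_on_vecI:
  assumes "\<And>i. continuous_on A (\<lambda>x. f x $ i)"
  shows "continuous_on A (f :: _ \<Rightarrow> real^'n)"
  using continuous_on_vec_lambda[of A "\<lambda>i x. f x $ i"] assms by simp

lemma continuous_on_hemi: "continuous_on A (hemi s)"
proof (rule continuous_on_vecI)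
  fix i :: 3
  show "continuous_on A (\<lambda>x. hemi s x $ i)"
    using exhaust_3[of i] by (elim disjE) (simp_all, (intro continuous_intros)+)
qed

lemma continuous_on_shadow: "continuous_on A shadow"
proof (rule continuous_on_vecI)
  fix i :: 2
  show "continuous_on A (\<lambda>x. shadow x $ i)"
    using exhaust_2[of i] by (elim disjE) (simp_all, (intro continuous_intros)+)
qed

lemma hemi_in_S2:
  assumes "norm x \<le> 1" "s\<^sup>2 = 1"
  shows "hemi s x \<in> S2"
proof -
  have "(norm x)\<^sup>2 \<le> 1"
    using assms by (simp add: power_le_one)
  then have "(norm (hemi s x))\<^sup>2 = 1"
    using assms by (simp add: norm_sq_3 power_mult_distrib norm_sq_2)
  then show ?thesis
    by (simp add: S2_def power2_eq_1_iff) (smt (verit) norm_ge_zero)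
qed

lemma hemi_shadow:
  assumes "z \<in> S2" "0 \<le> s * z$3" "s\<^sup>2 = 1"
  shows "hemi s (shadow z) = z"
proof -
  have "(z$1)\<^sup>2 + (z$2)\<^sup>2 + (z$3)\<^sup>2 = 1"
    using assms by (simp add: S2_def flip: norm_sq_3)
  then have "1 - (norm (shadow z))\<^sup>2 = (s * z$3)\<^sup>2"
    using assms by (simp add: norm_sq_2 power_mult_distrib)
  then have "s * sqrt (1 - (norm (shadow z))\<^sup>2) = s * s * z$3"
    using assms by simp
  also have "\<dots> = z$3"
    using assms(3) by (simp add: power2_eq_square)
  finally show ?thesis
    by (simp add: vec_eq_iff forall_3)
qed

lemma shadow_norm_less:
  assumes "z \<in> S2" "z$3 \<noteq> 0"
  shows "norm (shadow z) < 1"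
proof -
  have "(z$1)\<^sup>2 + (z$2)\<^sup>2 + (z$3)\<^sup>2 = 1"
    using assms by (simp add: S2_def flip: norm_sq_3)
  then have "(norm (shadow z))\<^sup>2 < 1"
    using assms by (simp add: norm_sq_2) (smt (verit) zero_less_power2)
  then show ?thesis
    by (simp add: power2_less_1_iff)
qed

lemma hemi_circle: "norm x = 1 \<Longrightarrow> hemi s x = hemi s' x"
  by (simp add: hemi_def)

lemma hemi_opposite:
  assumes "hemi s x = hemi (- s) y" "norm x \<le> 1" "s\<^sup>2 = 1"
  shows "x = y \<and> norm x = 1"
proof -
  have "x = y"
    using arg_cong[OF assms(1), of shadow] by simp
  moreover have "s * sqrt (1 - (norm x)\<^sup>2) = 0"
    using arg_cong[OF assms(1), of "\<lambda>z. z$3"] \<open>x = y\<close> by simp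
  ultimately show ?thesis
    using assms by (auto simp: power2_eq_1_iff) (smt (verit) norm_ge_zero)+
qed

text \<open>The chart is the vertical projection followed by an affine map whose coordinates are the
  two line functions, scaled to the unit disc. It lives in one open hemisphere, so the hypotheses on
  \<open>g\<close> and \<open>h\<close> speak only of their traces there.\<close>

lemma proper_crossing_hemi:
  assumes s: "s\<^sup>2 = 1" and x: "norm x < 1"
    and ab: "a \<noteq> b" and cd: "c \<noteq> d" and ne: "{a, b} \<noteq> {c, d}"
    and xab: "orient (pt a) (pt b) x = 0" and xcd: "orient (pt c) (pt d) x = 0"
    and g: "\<And>y. norm y < 1 \<Longrightarrow> hemi s y \<in> path_image g \<longleftrightarrow> orient (pt a) (pt b) y = 0"
    and h: "\<And>y. norm y < 1 \<Longrightarrow> hemi s y \<in> path_image h \<longleftrightarrow> orient (pt c) (pt d) y = 0"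
  shows "proper_crossing g h (hemi s x)"
proof -
  define A1 B1 where "A1 = - (pt b $ 2 - pt a $ 2)" and "B1 = pt b $ 1 - pt a $ 1"
  define A2 B2 where "A2 = - (pt d $ 2 - pt c $ 2)" and "B2 = pt d $ 1 - pt c $ 1"
  \<comment> \<open>The determinant of the two line functions. If it vanished, the lines would be
    parallel and both pass through \<open>x\<close>, hence coincide, against
    \<open>ne\<close>.\<close>
  define D where "D = A2 * B1 - B2 * A1"
  have L1: "orient (pt a) (pt b) y = A1 * (y$1 - x$1) + B1 * (y$2 - x$2)" for y
    using xab unfolding orient_def A1_def B1_def by algebra
  have L2: "orient (pt c) (pt d) y = A2 * (y$1 - x$1) + B2 * (y$2 - x$2)" for y
    using xcd unfolding orient_def A2_def B2_def by algebra
  have D: "D \<noteq> 0"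
  proof
    assume "D = 0"
    have "x \<in> closed_segment (pt a) (pt b)"
      using disc_line_segment xab ab x by simp
    then obtain u where u: "x = (1 - u) *\<^sub>R pt a + u *\<^sub>R pt b"
      by (auto simp: closed_segment_def)
    have "orient (pt c) (pt d) (pt a) = - u * D" "orient (pt c) (pt d) (pt b) = (1 - u) * D"
      unfolding L2 u D_def A1_def B1_def by (simp_all add: algebra_simps)
    then have "a = c \<or> a = d" "b = c \<or> b = d"
      using \<open>D = 0\<close> cd by (auto simp: orient_pt_eq_0_iff)
    then show False
      using ne ab by auto
  qed
  \<comment> \<open>The second line function comes first, because \<open>proper_crossing\<close>
    sends \<open>g\<close> to the axis on which the second coordinate is 0.\<close>
  define F :: "real^2 \<Rightarrow> real^2"
    where "F y = vector [A2 * (y$1 - x$1) + B2 * (y$2 - x$2), A1 * (y$1 - x$1) + B1 * (y$2 - x$2)]" for y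
  define G :: "real^2 \<Rightarrow> real^2"
    where "G w = vector [x$1 + (B1 * w$1 - B2 * w$2) / D, x$2 + (A2 * w$2 - A1 * w$1) / D]" for w
  have FG: "F (G w) = w" for w
    unfolding F_def G_def using D by (simp add: vec_eq_iff forall_2 divide_simps) (simp add: D_def algebra_simps)
  have GF: "G (F y) = y" for y
  proof -
    have "B1 * F y $ 1 - B2 * F y $ 2 = D * (y$1 - x$1)" "A2 * F y $ 2 - A1 * F y $ 1 = D * (y$2 - x$2)"
      unfolding F_def D_def by (simp_all add: algebra_simps)
    then show ?thesis
      using D by (simp add: G_def vec_eq_iff forall_2)
  qed
  have Fx: "F x = 0"
    by (simp add: F_def vec_eq_iff forall_2)
  have contF: "continuous_on S F" for S
  proof (rule continuous_on_vecI)
    fix i :: 2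
    show "continuous_on S (\<lambda>x. F x $ i)"
      unfolding F_def using exhaust_2[of i] by (elim disjE) (simp_all, (intro continuous_intros)+)
  qed
  have contG: "continuous_on S G" for S
  proof (rule continuous_on_vecI)
    fix i :: 2
    show "continuous_on S (\<lambda>x. G x $ i)"
      unfolding G_def using exhaust_2[of i] D by (elim disjE) (simp_all, (intro continuous_intros; simp)+)
  qed
  \<comment> \<open>The radius \<open>r\<close> is so small that \<open>G\<close> maps the disc of
    radius \<open>r\<close> into the open unit disc, which keeps the chart off the equator.\<close>
  have "open (G -` ball 0 1)"
    using contG[of UNIV] by (simp add: open_vimage)
  moreover have "0 \<in> G -` ball 0 1"
    using GF[of x] Fx x by simp
  ultimately obtain r where r: "0 < r" "ball 0 r \<subseteq> G -` ball 0 1"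
    by (metis openE)
  have Gr: "norm (G w) < 1" if "norm w < r" for w
    using r that by (auto simp: subset_eq)
  define U where "U = S2 \<inter> {z. 0 < s * z$3 \<and> norm (F (shadow z)) < r}"
  define \<phi> where "\<phi> z = (1 / r) *\<^sub>R F (shadow z)" for z
  define \<psi> where "\<psi> w = hemi s (G (r *\<^sub>R w))" for w
  have contFs: "continuous_on S (\<lambda>z. F (shadow z))" for S
    using continuous_on_compose[OF continuous_on_shadow contF, of S] by (simp add: o_def)
  have "open {z. 0 < s * z$3 \<and> norm (F (shadow z)) < r}"
    unfolding Collect_conj_eq
    by (intro open_Int open_Collect_less continuous_intros contFs)
  then have opU: "openin (top_of_set S2) U"
    unfolding U_def by (simp add: openin_open_Int)
  have U1: "z = hemi s (shadow z)" "norm (shadow z) < 1" if "z \<in> U" for z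
  proof -
    have z: "z \<in> S2" "0 < s * z$3" "z$3 \<noteq> 0"
      using that by (auto simp: U_def)
    show "z = hemi s (shadow z)"
      using hemi_shadow[of z s] z s by simp
    show "norm (shadow z) < 1"
      using shadow_norm_less z by blast
  qed
  have up: "0 < s * hemi s y $ 3" if "norm y < 1" for y
  proof -
    have "(norm y)\<^sup>2 < 1"
      using that abs_square_less_1[of "norm y"] by simp
    moreover have "s * s = 1"
      using s by (simp add: power2_eq_square)
    ultimately show ?thesis
      by (simp flip: mult.assoc)
  qed
  have U2: "hemi s y \<in> U" if "norm (F y) < r" for y
  proof -
    have "norm y < 1"
      using Gr[OF that] by (simp add: GF)
    then show ?thesis
      using that up[of y] s hemi_in_S2[of y s] by (simp add: U_def)
  qed
  have pU: "hemi s x \<in> U"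
    using U2[of x] r by (simp add: Fx)
  have \<phi>ball: "\<phi> z \<in> ball 0 1" if "z \<in> U" for z
    using that r by (simp add: U_def \<phi>_def)
  have \<psi>U: "\<psi> w \<in> U" if "w \<in> ball 0 1" for w
    unfolding \<psi>_def by (rule U2) (use that r in \<open>simp add: FG\<close>)
  have \<psi>\<phi>: "\<psi> (\<phi> z) = z" if "z \<in> U" for z
    using U1[OF that] r by (simp add: \<psi>_def \<phi>_def GF)
  have \<phi>\<psi>: "\<phi> (\<psi> w) = w" for w
    using r by (simp add: \<psi>_def \<phi>_def FG)
  have hom: "homeomorphism U (ball 0 1) \<phi> \<psi>"
  proof (rule homeomorphismI)
    show "continuous_on U \<phi>"
      unfolding \<phi>_def by (intro continuous_intros contFs)
    have "continuous_on (ball 0 1) (\<lambda>w. G (r *\<^sub>R w))"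
      by (rule continuous_on_compose2[OF contG[of UNIV]]) (auto intro!: continuous_intros)
    then show "continuous_on (ball 0 1) \<psi>"
      unfolding \<psi>_def by (rule continuous_on_compose2[OF continuous_on_hemi[of UNIV]]) auto
  qed (use \<phi>ball \<psi>U \<psi>\<phi> \<phi>\<psi> in auto)
  have axis: "\<phi> ` (path_image k \<inter> U) = {w \<in> ball 0 1. w $ i = 0}"
    if k: "\<And>y. norm y < 1 \<Longrightarrow> hemi s y \<in> path_image k \<longleftrightarrow> F y $ i = 0" for k i
  proof (intro equalityI subsetI)
    fix w assume "w \<in> \<phi> ` (path_image k \<inter> U)"
    then obtain z where z: "z \<in> path_image k" "z \<in> U" "w = \<phi> z"
      by auto
    then have "F (shadow z) $ i = 0"
      using k[of "shadow z"] U1[of z] by simp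
    then show "w \<in> {w \<in> ball 0 1. w $ i = 0}"
      using \<phi>ball z by (simp add: \<phi>_def)
  next
    fix w :: "real^2" assume w: "w \<in> {w \<in> ball 0 1. w $ i = 0}"
    then have "norm (G (r *\<^sub>R w)) < 1"
      using r by (intro Gr) simp
    then have "\<psi> w \<in> path_image k"
      using k[of "G (r *\<^sub>R w)"] w by (simp add: \<psi>_def FG)
    then show "w \<in> \<phi> ` (path_image k \<inter> U)"
      using \<psi>U[of w] w \<phi>\<psi>[of w] by (metis (no_types, lifting) IntI imageI mem_Collect_eq)
  qed
  show ?thesis
    unfolding proper_crossing_def
  proof (intro exI conjI)
    show "\<phi> ` (path_image g \<inter> U) = {w \<in> ball 0 1. w $ 2 = 0}"
      by (rule axis) (simp add: g L1 F_def)
    show "\<phi> ` (path_image h \<inter> U) = {w \<in> ball 0 1. w $ 1 = 0}"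
      by (rule axis) (simp add: h L2 F_def)
    show "\<phi> (hemi s x) = 0"
      by (simp add: \<phi>_def Fx)
  qed (use opU pU hom in auto)
qed

text \<open>The equator has empty interior in the sphere: shrinking the shadow of a point radially
  moves the point off it.\<close>

lemma off_equator:
  assumes "openin (top_of_set S2) R" "R \<noteq> {}"
  obtains z where "z \<in> R" "z$3 \<noteq> 0"
proof -
  obtain z where z: "z \<in> R"
    using assms by auto
  obtain W where W: "open W" "R = S2 \<inter> W"
    using assms by (auto simp: openin_open)
  show ?thesis
  proof (cases "z$3 = 0")
    case False
    then show ?thesis using that z by blast
  next
    case True
    have zS: "z \<in> S2" and zW: "z \<in> W"
      using z W by auto
    have hz: "hemi 1 (shadow z) = z"
      using hemi_shadow[of z 1] zS True by simp
    have nz: "norm (shadow z) = 1"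
    proof -
      have "(z$1)\<^sup>2 + (z$2)\<^sup>2 + (z$3)\<^sup>2 = 1"
        using zS by (simp add: S2_def flip: norm_sq_3)
      then have "(norm (shadow z))\<^sup>2 = 1"
        by (simp add: norm_sq_2 True)
      then show ?thesis
        by (simp add: power2_eq_1_iff) (smt (verit) norm_ge_zero)
    qed
    have cont: "continuous_on UNIV (\<lambda>u::real. hemi 1 (u *\<^sub>R shadow z))"
      by (rule continuous_on_compose2[OF continuous_on_hemi[of UNIV]]) (auto intro!: continuous_intros)
    have "open ((\<lambda>u::real. hemi 1 (u *\<^sub>R shadow z)) -` W)"
      using W cont by (simp add: open_vimage)
    moreover have "1 \<in> (\<lambda>u::real. hemi 1 (u *\<^sub>R shadow z)) -` W"
      using zW hz by simp
    ultimately obtain e where e: "0 < e" "ball 1 e \<subseteq> (\<lambda>u::real. hemi 1 (u *\<^sub>R shadow z)) -` W"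
      by (metis openE)
    \<comment> \<open>A factor below 1 but within \<open>e\<close> of it; the bound
      \<open>1 / 2\<close> keeps it positive.\<close>
    define u where "u = max (1 / 2) (1 - e / 2)"
    have u: "0 < u" "u < 1" "u \<in> ball 1 e"
      using e by (auto simp: u_def dist_real_def)
    define y where "y = hemi 1 (u *\<^sub>R shadow z)"
    have "norm (u *\<^sub>R shadow z) = u"
      using u nz by simp
    then have "y \<in> S2" "y$3 \<noteq> 0"
      using u by (auto simp: y_def hemi_in_S2 power2_eq_1_iff simp del: norm_scaleR)
    moreover have "y \<in> W"
      using e u by (auto simp: y_def)
    ultimately show ?thesis
      using that W by blast
  qed
qed

text \<open>Two lines never enclose a region of the disc: from a point off both, some ray parallel
  to the first line avoids the second. A generic starting point keeps the end of this ray out of the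
  finite set \<open>F\<close>.\<close>

lemma component_reaches_equator:
  assumes R: "R \<in> components (S2 - C)" and C: "closed C" and F: "finite F"
    and lines: "\<And>s. s\<^sup>2 = 1 \<Longrightarrow> \<exists>n1 c1 n2 c2. n1 \<noteq> (0 :: real^2) \<and> n2 \<noteq> (0 :: real^2) \<and>
           (\<forall>x. norm x < 1 \<and> hemi s x \<in> C \<longrightarrow> n1 \<bullet> x = c1 \<or> n2 \<bullet> x = c2)"
    and equator: "\<And>x. norm x = 1 \<Longrightarrow> hemi 1 x \<in> C \<Longrightarrow> x \<in> F"
  obtains x where "norm x = 1" "x \<notin> F" "hemi 1 x \<in> R"
proof -
  have op: "openin (top_of_set S2) (S2 - C)"
    using C by (simp add: Diff_eq openin_open_Int open_Compl)
  moreover have "locally connected S2"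
    unfolding S2_def by (rule locally_connected_sphere)
  ultimately have opR: "openin (top_of_set S2) R"
    using openin_trans[OF openin_components_locally_connected[OF locally_open_subset R]] by blast
  have "R \<noteq> {}"
    using R by (rule in_components_nonempty)
  then obtain z where z: "z \<in> R" "z$3 \<noteq> 0"
    using off_equator opR by blast
  define s where "s = sgn (z$3)"
  have s: "s\<^sup>2 = 1" "0 < s * z$3"
    using z by (auto simp: s_def sgn_if power2_eq_square)
  have zS: "z \<in> S2"
    using z in_components_subset[OF R] by auto
  obtain n1 c1 n2 c2 where n_all: "n1 \<noteq> (0 :: real^2) \<and> n2 \<noteq> (0 :: real^2) \<and>
      (\<forall>x. norm x < 1 \<and> hemi s x \<in> C \<longrightarrow> n1 \<bullet> x = c1 \<or> n2 \<bullet> x = c2)"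
    using lines[OF s(1)] by (elim exE) (rule that)
  then have n: "n1 \<noteq> 0" "n2 \<noteq> 0"
      "\<And>x. norm x < 1 \<Longrightarrow> hemi s x \<in> C \<Longrightarrow> n1 \<bullet> x = c1 \<or> n2 \<bullet> x = c2"
    by simp_all
  obtain W where W: "open W" "R = S2 \<inter> W"
    using opR by (auto simp: openin_open)
  define V where "V = ball 0 1 \<inter> hemi s -` W"
  have "open V"
    unfolding V_def using W continuous_on_hemi[of UNIV s] by (intro open_Int open_vimage) auto
  moreover have "shadow z \<in> V"
    using hemi_shadow[of z s] shadow_norm_less[of z] zS z s W by (simp add: V_def)
  ultimately have "\<not> negligible V"
    using open_not_negligible by blast
  \<comment> \<open>The last family consists of the parallels to the first line through the points
    of \<open>F\<close>; starting on one of them, the ray could end in \<open>F\<close>.\<close>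
  moreover have "negligible ({x. n1 \<bullet> x = c1} \<union> {x. n2 \<bullet> x = c2} \<union> (\<Union>f\<in>F. {x. n1 \<bullet> x = n1 \<bullet> f}))"
    using n F by (intro negligible_Un negligible_Union finite_imageI) (auto intro!: negligible_hyperplane)
  ultimately have "\<not> V \<subseteq> {x. n1 \<bullet> x = c1} \<union> {x. n2 \<bullet> x = c2} \<union> (\<Union>f\<in>F. {x. n1 \<bullet> x = n1 \<bullet> f})"
    by (metis negligible_subset)
  then obtain x where x: "x \<in> V" "n1 \<bullet> x \<noteq> c1" "n2 \<bullet> x \<noteq> c2" and xF: "\<And>f. f \<in> F \<Longrightarrow> n1 \<bullet> x \<noteq> n1 \<bullet> f"
    by auto
  have nx: "norm x < 1"
    using x by (simp add: V_def)
  have xR: "hemi s x \<in> R"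
    using x s W by (simp add: V_def hemi_in_S2)
  \<comment> \<open>Move parallel to the first line, in the direction that does not approach the second one.\<close>
  define v :: "real^2" where "v = vector [- (n1 $ 2), n1 $ 1]"
  define d where "d = (if 0 \<le> (n2 \<bullet> x - c2) * (n2 \<bullet> v) then v else - v)"
  have "n1 \<bullet> v = 0"
    by (simp add: v_def inner_vec_def sum_2)
  then have nd: "n1 \<bullet> d = 0"
    by (simp add: d_def)
  have "v \<noteq> 0"
    using n(1) by (auto simp: v_def vec_eq_iff forall_2)
  then have d0: "d \<noteq> 0"
    by (simp add: d_def)
  have d2: "0 \<le> (n2 \<bullet> x - c2) * (n2 \<bullet> d)"
    by (auto simp: d_def)
  obtain \<tau> where \<tau>: "0 < \<tau>" "x + \<tau> *\<^sub>R d \<in> frontier (ball 0 1)"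
      "\<And>e. \<lbrakk>0 \<le> e; e < \<tau>\<rbrakk> \<Longrightarrow> x + e *\<^sub>R d \<in> interior (ball 0 1)"
    using ray_to_frontier[of "ball 0 1" x d] nx d0 by (auto simp: interior_open)
  define y where "y = x + \<tau> *\<^sub>R d"
  have ny: "norm y = 1"
    using \<tau>(2) by (simp add: y_def)
  have yF: "y \<notin> F"
    using xF[of y] by (auto simp: y_def inner_add_right nd)
  have "hemi s ` closed_segment x y \<subseteq> S2 - C"
  proof (intro image_subsetI DiffI)
    fix w assume "w \<in> closed_segment x y"
    then obtain u where u: "0 \<le> u" "u \<le> 1" "w = x + (u * \<tau>) *\<^sub>R d"
      by (auto simp: closed_segment_def y_def algebra_simps)
    have *: "norm w < 1 \<or> w = y"
    proof (cases "u = 1")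
      case False
      then have "w \<in> interior (ball 0 1)"
        unfolding u(3) using u \<tau> by (intro \<tau>(3)) auto
      then show ?thesis by (simp add: interior_open)
    qed (simp add: u(3) y_def)
    then show "hemi s w \<in> S2"
      using ny s by (auto simp: hemi_in_S2)
    have 1: "n1 \<bullet> w \<noteq> c1"
      using x(2) by (simp add: u(3) inner_add_right nd)
    have 2: "n2 \<bullet> w \<noteq> c2"
    proof
      assume "n2 \<bullet> w = c2"
      then have "(n2 \<bullet> x - c2) + (u * \<tau>) * (n2 \<bullet> d) = 0"
        by (simp add: u(3) inner_add_right)
      then have "(n2 \<bullet> x - c2) * (n2 \<bullet> x - c2) + (u * \<tau>) * ((n2 \<bullet> x - c2) * (n2 \<bullet> d)) = 0"
        by algebra
      moreover have "0 \<le> (u * \<tau>) * ((n2 \<bullet> x - c2) * (n2 \<bullet> d))"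
        using u \<tau> d2 by simp
      moreover have "0 < (n2 \<bullet> x - c2) * (n2 \<bullet> x - c2)"
        using x(3) by (metis not_real_square_gt_zero right_minus_eq)
      ultimately show False by simp
    qed
    show "hemi s w \<notin> C"
      using * 1 2 n(3)[of w] yF equator[of y] ny hemi_circle[OF ny, of s 1] by auto
  qed
  moreover have "connected (hemi s ` closed_segment x y)"
    by (intro connected_continuous_image continuous_on_hemi) simp
  ultimately have "hemi s ` closed_segment x y \<subseteq> R"
    using components_maximal[OF R] xR by blast
  then have "hemi 1 y \<in> R"
    using hemi_circle[OF ny, of s 1] ends_in_segment(2)[of y x] by (metis image_subset_iff)
  then show ?thesis
    using that ny yF by blast
qed

lemma circle_eq_pt:
  assumes "norm x = 1" "x \<noteq> vector [-1, 0]"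
  obtains t where "x = pt t"
proof -
  have c: "(x$1)\<^sup>2 + (x$2)\<^sup>2 = 1"
    using assms by (simp flip: norm_sq_2)
  have n: "1 + x$1 \<noteq> 0"
  proof
    assume "1 + x$1 = 0"
    then have "x$1 = -1" by simp
    then show False
      using c assms by (auto simp: vec_eq_iff forall_2)
  qed
  \<comment> \<open>The slope of the line from \<open>(-1, 0)\<close> to \<open>x\<close>, which
    inverts the parametrisation.\<close>
  define t where "t = x$2 / (1 + x$1)"
  have t: "t * (1 + x$1) = x$2"
    using n by (simp add: t_def)
  have p: "1 + t\<^sup>2 \<noteq> 0"
    by (smt (verit) zero_le_power2)
  have "(t * (1 + x$1))\<^sup>2 = (1 - x$1) * (1 + x$1)"
    unfolding t using c by (simp add: algebra_simps power2_eq_square)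
  then have "(t\<^sup>2 * (1 + x$1)) * (1 + x$1) = (1 - x$1) * (1 + x$1)"
    by (simp add: power2_eq_square mult_ac)
  then have t2: "t\<^sup>2 * (1 + x$1) = 1 - x$1"
    using n by simp
  have "x$1 * (1 + t\<^sup>2) = 1 - t\<^sup>2"
    using t2 by (simp add: algebra_simps)
  moreover have "x$2 * (1 + t\<^sup>2) = 2 * t"
  proof -
    have "x$2 * (1 + t\<^sup>2) = t * ((1 + x$1) + t\<^sup>2 * (1 + x$1))"
      unfolding t[symmetric] by (simp add: algebra_simps)
    then show ?thesis
      by (simp add: t2)
  qed
  ultimately have "x = pt t"
    using p by (simp add: pt_def vec_eq_iff forall_2 eq_divide_eq)
  then show ?thesis by (rule that)
qed

subsection \<open>The edge set\<close>

text \<open>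
  Equatorial positions are \<open>0, \<dots>, 2n - 1\<close>, vertex \<open>i\<close> having position \<open>2i\<close>. The triple \<open>(a, m, b)\<close> stands
  for the edge that follows the upper chord from \<open>a\<close> to \<open>m\<close> and then the lower chord from \<open>m\<close> to \<open>b\<close>; one of the
  two is degenerate unless the edge is woven.
\<close>
type_synonym edge = "nat \<times> nat \<times> nat"

definition upper_edges :: "nat \<Rightarrow> edge set" where
  "upper_edges n = {(2 * i, 2 * j, 2 * j) | i j. i < j \<and> j < n \<and> (j \<le> i + 2 \<or> i = 0 \<or> j + 1 = n)}"

text \<open>The conditions \<open>i + 2 \<le> j\<close> and
  \<open>i \<noteq> 0 \<or> j + 1 \<noteq> n\<close> remove the cycle edges, including the closing
  one between \<open>0\<close> and \<open>n - 1\<close>. Such an edge and its upper copy would bound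
  a lens without a vertex.\<close>

definition lower_edges :: "nat \<Rightarrow> edge set" where
  "lower_edges n = {(2 * i, 2 * i, 2 * j) | i j. i + 2 \<le> j \<and> j < n \<and> (i \<noteq> 0 \<or> j + 1 \<noteq> n) \<and>
     (j = i + 2 \<or> i = 0 \<or> j + 1 = n)}"

definition weave :: "nat \<Rightarrow> nat \<Rightarrow> edge" where
  "weave n i = (2 * i, (2 * i + 3) mod (2 * n), (2 * i + 6) mod (2 * n))"

definition all_edges :: "nat \<Rightarrow> edge set" where
  "all_edges n = upper_edges n \<union> lower_edges n \<union> weave n ` {..<n}"

text \<open>\<open>s\<close> is meant as a sign; every value other than 1 counts as the lower
  hemisphere.\<close>

fun chord :: "real \<Rightarrow> edge \<Rightarrow> nat \<times> nat" where
  "chord s (a, m, b) = (if s = 1 then (a, m) else (m, b))"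

fun edge_ends :: "edge \<Rightarrow> nat set" where
  "edge_ends (a, m, b) = {a, b}"

fun cross_on :: "real \<Rightarrow> edge \<Rightarrow> edge \<Rightarrow> bool" where
  "cross_on s e f \<longleftrightarrow> interleaved (fst (chord s e)) (snd (chord s e)) (fst (chord s f)) (snd (chord s f))"

section \<open>Crossing patterns of the edges\<close>

lemma interleaved_normal:
  assumes "a < b" "c < d"
  shows "interleaved a b c d \<longleftrightarrow> a < c \<and> c < b \<and> b < d \<or> c < a \<and> a < d \<and> d < b"
  using assms by (auto simp: interleaved_def)

lemma interleaved_degenerate [simp]: "\<not> interleaved a a c d" "\<not> interleaved a b c c"
  by (auto simp: interleaved_def)

lemma interleaved_distinct:
  "interleaved a b c d \<Longrightarrow> a \<noteq> c \<and> a \<noteq> d \<and> b \<noteq> c \<and> b \<noteq> d \<and> a \<noteq> b \<and> c \<noteq> d"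
  by (auto simp: interleaved_def)

lemma mod_wrap: "x < 2 * m \<Longrightarrow> x mod m = (if x < m then x else x - m)" for x m :: nat
  by (simp add: le_mod_geq)

text \<open>In the last three cases coordinates wrap around modulo \<open>2 * n\<close>. With
  explicit coordinates, the crossing lemmas become linear arithmetic.\<close>

lemma weave_cases:
  assumes "4 \<le> n" "i < n"
  obtains "i + 4 \<le> n" "weave n i = (2 * i, 2 * i + 3, 2 * i + 6)"
    | "n = i + 3" "weave n i = (2 * i, 2 * i + 3, 0)"
    | "n = i + 2" "weave n i = (2 * i, 2 * i + 3, 2)"
    | "n = i + 1" "weave n i = (2 * i, 1, 4)"
proof -
  have "i + 4 \<le> n \<or> n = i + 3 \<or> n = i + 2 \<or> n = i + 1"
    using assms by linarith
  then show ?thesis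
    using assms that by (auto simp: weave_def mod_wrap)
qed

text \<open>Pairwise crossing chords share no end, so at most one of three starts at
  \<open>0\<close> and at most one ends at \<open>n - 1\<close>. The third spans at most one vertex,
  and both others would have to end at that vertex.\<close>

lemma no_three_interleaved:
  fixes i j k l p q n :: nat
  assumes "i < j" "k < l" "p < q" "j < n" "l < n" "q < n"
    and "j \<le> i + 2 \<or> i = 0 \<or> j + 1 = n" "l \<le> k + 2 \<or> k = 0 \<or> l + 1 = n" "q \<le> p + 2 \<or> p = 0 \<or> q + 1 = n"
  shows "\<not> (interleaved (2 * i) (2 * j) (2 * k) (2 * l) \<and> interleaved (2 * k) (2 * l) (2 * p) (2 * q) \<and>
           interleaved (2 * i) (2 * j) (2 * p) (2 * q))"
  using assms by (auto simp: interleaved_normal)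

lemma upper_triangle_free:
  assumes "e \<in> upper_edges n" "f \<in> upper_edges n" "g \<in> upper_edges n"
  shows "\<not> (cross_on 1 e f \<and> cross_on 1 f g \<and> cross_on 1 e g)"
  using assms unfolding upper_edges_def by (elim CollectE exE conjE) (simp add: no_three_interleaved)

lemma lower_triangle_free:
  assumes "e \<in> lower_edges n" "f \<in> lower_edges n" "g \<in> lower_edges n"
  shows "\<not> (cross_on (-1) e f \<and> cross_on (-1) f g \<and> cross_on (-1) e g)"
proof -
  \<comment> \<open>Up to the place of the middle component, the lower edges are among the upper
    ones.\<close>
  have "\<exists>i j. e = (2 * i, 2 * i, 2 * j) \<and> i < j \<and> j < n \<and> (j \<le> i + 2 \<or> i = 0 \<or> j + 1 = n)"
    if "e \<in> lower_edges n" for e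
    using that unfolding lower_edges_def by fastforce
  from this[OF assms(1)] this[OF assms(2)] this[OF assms(3)] show ?thesis
    by (elim exE conjE) (simp add: no_three_interleaved)
qed

text \<open>The upper chord of a woven edge cuts off the single vertex \<open>i + 1\<close>, at
  which every straight edge crossing it must end.\<close>

lemma weave_cross_upper:
  assumes "4 \<le> n" "i < n" "e \<in> upper_edges n" "cross_on 1 (weave n i) e"
  shows "2 * ((i + 1) mod n) \<in> edge_ends e"
proof -
  obtain x y where e: "e = (2 * x, 2 * y, 2 * y)" and xy: "x < y" "y < n"
    using assms(3) unfolding upper_edges_def by fastforce
  have "x = (i + 1) mod n \<or> y = (i + 1) mod n"
    using assms(1,2)
  proof (cases rule: weave_cases)
    case 1
    then have "interleaved (2 * i) (2 * i + 3) (2 * x) (2 * y)"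
      using assms(4) by (simp add: e)
    then show ?thesis
      using xy 1(1) assms(1,2) unfolding interleaved_def by (simp; presburger)
  next
    case 2
    then have "interleaved (2 * i) (2 * i + 3) (2 * x) (2 * y)"
      using assms(4) by (simp add: e)
    then show ?thesis
      using xy 2(1) assms(1,2) unfolding interleaved_def by (simp; presburger)
  next
    case 3
    then have "interleaved (2 * i) (2 * i + 3) (2 * x) (2 * y)"
      using assms(4) by (simp add: e)
    then show ?thesis
      using xy 3(1) assms(1,2) unfolding interleaved_def by (simp; presburger)
  next
    case 4
    then have "interleaved (2 * i) 1 (2 * x) (2 * y)"
      using assms(4) by (simp add: e)
    then show ?thesis
      using xy 4(1) assms(1,2) unfolding interleaved_def by (simp add: mod_wrap; presburger)
  qed
  then show ?thesis
    by (auto simp: e)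
qed

text \<open>The lower chord of a woven edge cuts off the single vertex \<open>i + 2\<close>.\<close>

lemma weave_cross_lower:
  assumes "4 \<le> n" "i < n" "e \<in> lower_edges n" "cross_on (-1) (weave n i) e"
  shows "2 * ((i + 2) mod n) \<in> edge_ends e"
proof -
  obtain x y where e: "e = (2 * x, 2 * x, 2 * y)" and xy: "x < y" "y < n"
    using assms(3) unfolding lower_edges_def by fastforce
  have "x = (i + 2) mod n \<or> y = (i + 2) mod n"
    using assms(1,2)
  proof (cases rule: weave_cases)
    case 1
    then have "interleaved (2 * i + 3) (2 * i + 6) (2 * x) (2 * y)"
      using assms(4) by (simp add: e)
    then show ?thesis
      using xy 1(1) assms(1,2) unfolding interleaved_def by (simp; presburger)
  next
    case 2
    then have "interleaved (2 * i + 3) 0 (2 * x) (2 * y)"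
      using assms(4) by (simp add: e)
    then show ?thesis
      using xy 2(1) assms(1,2) unfolding interleaved_def by (simp; presburger)
  next
    case 3
    then have "interleaved (2 * i + 3) 2 (2 * x) (2 * y)"
      using assms(4) by (simp add: e)
    then show ?thesis
      using xy 3(1) assms(1,2) unfolding interleaved_def by (simp; presburger)
  next
    case 4
    then have "interleaved 1 4 (2 * x) (2 * y)"
      using assms(4) by (simp add: e)
    then show ?thesis
      using xy 4(1) assms(1,2) unfolding interleaved_def by (simp add: mod_wrap; presburger)
  qed
  then show ?thesis
    by (auto simp: e)
qed

text \<open>A chord of a woven edge cuts off two positions, one even and one odd. Another woven edge
  can use one of these in the same hemisphere only if its index is next to \<open>i\<close>.\<close>

lemma weave_cross_weave:
  assumes "4 \<le> n" "i < n" "j < n" "cross_on s (weave n i) (weave n j)"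
  shows "j = (i + 1) mod n \<or> i = (j + 1) mod n"
  by (rule weave_cases[OF assms(1,2)]; rule weave_cases[OF assms(1,3)];
      use assms in \<open>auto simp: interleaved_def mod_wrap split: if_splits\<close>)

definition crosses :: "edge \<Rightarrow> edge \<Rightarrow> bool" where
  "crosses e f \<longleftrightarrow> cross_on 1 e f \<or> cross_on (-1) e f"

lemma cross_on_sym: "cross_on s e f \<longleftrightarrow> cross_on s f e"
  by (simp add: interleaved_sym)

lemma crosses_sym: "crosses e f \<longleftrightarrow> crosses f e"
  by (simp add: crosses_def cross_on_sym del: cross_on.simps)

lemma upper_crosses: "e \<in> upper_edges n \<Longrightarrow> crosses f e \<longleftrightarrow> cross_on 1 f e"
  by (auto simp: crosses_def upper_edges_def)

lemma lower_crosses: "e \<in> lower_edges n \<Longrightarrow> crosses f e \<longleftrightarrow> cross_on (-1) f e"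
  by (auto simp: crosses_def lower_edges_def)

lemma upper_lower_disjoint:
  "e \<in> upper_edges n \<Longrightarrow> f \<in> lower_edges n \<Longrightarrow> \<not> crosses e f"
  by (auto simp: crosses_def upper_edges_def lower_edges_def)

lemma upper_cross_ends:
  assumes "e \<in> upper_edges n" "cross_on 1 f e"
  shows "fst f \<notin> edge_ends e"
  using assms by (cases f) (auto simp: upper_edges_def dest: interleaved_distinct)

lemma lower_cross_ends:
  assumes "e \<in> lower_edges n" "cross_on (-1) f e"
  shows "snd (snd f) \<notin> edge_ends e"
  using assms by (cases f) (auto simp: lower_edges_def dest: interleaved_distinct)

lemma common_end_not_crosses:
  assumes "e \<in> upper_edges n \<union> lower_edges n" "f \<in> upper_edges n \<union> lower_edges n"
    and "v \<in> edge_ends e" "v \<in> edge_ends f"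
  shows "\<not> crosses e f"
  using assms by (auto simp: crosses_def upper_edges_def lower_edges_def dest: interleaved_distinct)

lemma weave_last: "snd (snd (weave n i)) = 2 * ((i + 3) mod n)"
proof -
  have "(2 * i + 6) mod (2 * n) = (2 * (i + 3)) mod (2 * n)"
    by simp
  then show ?thesis
    unfolding weave_def by (simp only: mult_mod_right snd_conv)
qed

text \<open>In the same hemisphere the two straight edges share the vertex cut off by the woven
  edge; in different hemispheres they cannot cross at all.\<close>

lemma weave_two_straight:
  assumes "4 \<le> n" "i < n" "e \<in> upper_edges n \<union> lower_edges n" "f \<in> upper_edges n \<union> lower_edges n"
    and "crosses (weave n i) e" "crosses (weave n i) f"
  shows "\<not> crosses e f"
proof (cases "e \<in> upper_edges n \<longleftrightarrow> f \<in> upper_edges n")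
  case True
  then have "\<exists>v. v \<in> edge_ends e \<and> v \<in> edge_ends f"
    using assms weave_cross_upper weave_cross_lower by (metis Un_iff upper_crosses lower_crosses)
  then show ?thesis
    using common_end_not_crosses assms by blast
next
  case False
  then show ?thesis
    using assms upper_lower_disjoint crosses_sym by blast
qed

text \<open>Above, crossing the first woven edge makes \<open>e\<close> end at the start of the
  second; below, crossing the second makes \<open>e\<close> end at the last vertex of the first.
  Either way \<open>e\<close> shares an end with a chord that it crosses.\<close>

lemma two_weave_straight:
  assumes "4 \<le> n" "i < n" "j < n" "e \<in> upper_edges n \<union> lower_edges n"
    and j: "j = (i + 1) mod n"
    and c: "crosses (weave n i) e" "crosses (weave n j) e"
  shows False
proof (cases "e \<in> upper_edges n")
  case True
  then have "2 * j \<in> edge_ends e"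
    using weave_cross_upper[of n i e] assms upper_crosses by metis
  moreover have "fst (weave n j) \<notin> edge_ends e"
    using upper_cross_ends True c upper_crosses by metis
  ultimately show ?thesis
    by (simp add: weave_def)
next
  case False
  then have e: "e \<in> lower_edges n"
    using assms by blast
  then have "2 * ((j + 2) mod n) \<in> edge_ends e"
    using weave_cross_lower[of n j e] assms lower_crosses by metis
  moreover have "(j + 2) mod n = (i + 3) mod n"
    unfolding j by (simp add: mod_simps numeral_eq_Suc)
  moreover have "snd (snd (weave n i)) \<notin> edge_ends e"
    using lower_cross_ends e c lower_crosses by metis
  ultimately show ?thesis
    by (simp add: weave_last)
qed

lemma weave_crosses_weave:
  "4 \<le> n \<Longrightarrow> i < n \<Longrightarrow> j < n \<Longrightarrow> crosses (weave n i) (weave n j) \<Longrightarrow> j = (i + 1) mod n \<or> i = (j + 1) mod n"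
  using weave_cross_weave unfolding crosses_def by metis

lemma no_three_crossing:
  assumes n: "4 \<le> n" and E: "e \<in> all_edges n" "f \<in> all_edges n" "g \<in> all_edges n"
    and c: "crosses e f" "crosses f g" "crosses e g"
  shows False
proof -
  define S where "S = upper_edges n \<union> lower_edges n"
  have all: "all_edges n = S \<union> weave n ` {..<n}"
    by (simp add: all_edges_def S_def)
  have SSS: False if "e \<in> S" "f \<in> S" "g \<in> S" "crosses e f" "crosses f g" "crosses e g" for e f g
    using that upper_triangle_free[of e n f g] lower_triangle_free[of e n f g] upper_lower_disjoint
      upper_crosses lower_crosses crosses_sym unfolding S_def by (metis UnE)
  have WSS: False if "i < n" "e \<in> S" "f \<in> S" "crosses (weave n i) e" "crosses (weave n i) f" "crosses e f" for i e f
    using that weave_two_straight[OF n] unfolding S_def by blast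
  have WWS: False if "i < n" "j < n" "e \<in> S" "crosses (weave n i) e" "crosses (weave n j) e" "crosses (weave n i) (weave n j)" for i j e
    using that two_weave_straight[OF n] weave_crosses_weave[OF n] unfolding S_def by blast
  \<comment> \<open>Three indices cannot be pairwise neighbours on a cycle of length at least
    4.\<close>
  have WWW: False if "i < n" "j < n" "k < n" "crosses (weave n i) (weave n j)" "crosses (weave n j) (weave n k)" "crosses (weave n i) (weave n k)" for i j k
  proof -
    have "j = (i + 1) mod n \<or> i = (j + 1) mod n" "k = (j + 1) mod n \<or> j = (k + 1) mod n" "k = (i + 1) mod n \<or> i = (k + 1) mod n"
      using that weave_crosses_weave[OF n] by blast+
    then show False
      using that n by (auto simp: mod_wrap split: if_splits)
  qed
  consider "e \<in> S" "f \<in> S" "g \<in> S" | "e \<notin> S" "f \<in> S" "g \<in> S" | "e \<in> S" "f \<notin> S" "g \<in> S" | "e \<in> S" "f \<in> S" "g \<notin> S"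
    | "e \<notin> S" "f \<notin> S" "g \<in> S" | "e \<notin> S" "f \<in> S" "g \<notin> S" | "e \<in> S" "f \<notin> S" "g \<notin> S" | "e \<notin> S" "f \<notin> S" "g \<notin> S"
    by blast
  then show False
  proof cases
    case 1 then show ?thesis using SSS c by blast
  next
    case 2 then show ?thesis using E c WSS unfolding all by blast
  next
    case 3 then show ?thesis using E c WSS crosses_sym unfolding all by blast
  next
    case 4 then show ?thesis using E c WSS crosses_sym unfolding all by blast
  next
    case 5 then show ?thesis using E c WWS unfolding all by blast
  next
    case 6 then show ?thesis using E c WWS crosses_sym unfolding all by blast
  next
    case 7 then show ?thesis using E c WWS crosses_sym unfolding all by blast
  next
    case 8 then show ?thesis using E c WWW unfolding all by blast
  qed
qed

section \<open>Recovering an edge from its middle or from a chord\<close>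

lemma all_edges_cases:
  assumes "e \<in> all_edges n"
  obtains (upper) i j where "e = (2 * i, 2 * j, 2 * j)" "i < j" "j < n" "e \<in> upper_edges n"
    | (lower) i j where "e = (2 * i, 2 * i, 2 * j)" "i + 2 \<le> j" "j < n" "i \<noteq> 0 \<or> j + 1 \<noteq> n" "e \<in> lower_edges n"
    | (weave) i where "i < n" "e = weave n i"
proof -
  consider "e \<in> upper_edges n" | "e \<in> lower_edges n" | "e \<in> weave n ` {..<n}"
    using assms unfolding all_edges_def by blast
  then show ?thesis
  proof cases
    case 1
    then obtain i j where "e = (2 * i, 2 * j, 2 * j)" "i < j" "j < n"
      unfolding upper_edges_def by blast
    then show ?thesis using upper 1 by blast
  next
    case 2
    then obtain i j where "e = (2 * i, 2 * i, 2 * j)" "i + 2 \<le> j" "j < n" "i \<noteq> 0 \<or> j + 1 \<noteq> n"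
      unfolding lower_edges_def by blast
    then show ?thesis using lower 2 by blast
  next
    case 3
    then show ?thesis using weave by blast
  qed
qed

lemma weave_mid_odd: "odd ((2 * i + 3) mod (2 * n))" for i n :: nat
  by (simp add: dvd_mod_iff)

lemma weave_mid_inj:
  fixes n i j :: nat
  assumes "4 \<le> n" "i < n" "j < n" "(2 * i + 3) mod (2 * n) = (2 * j + 3) mod (2 * n)"
  shows "i = j"
  using assms by (auto simp: mod_wrap split: if_splits)

lemma weave_edge: "weave n i = (2 * i, (2 * i + 3) mod (2 * n), 2 * ((i + 3) mod n))"
  using weave_last[of n i] by (simp add: weave_def)

lemma edge_wf:
  assumes "4 \<le> n" "(a, m, b) \<in> all_edges n"
  shows "a < 2 * n" "m < 2 * n" "b < 2 * n" "even a" "even b" "a \<noteq> b" "m = a \<or> m = b \<or> odd m"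
proof -
  have "a < 2 * n \<and> m < 2 * n \<and> b < 2 * n \<and> even a \<and> even b \<and> a \<noteq> b \<and> (m = a \<or> m = b \<or> odd m)"
    using assms(2)
  proof (cases rule: all_edges_cases)
    case (weave i)
    then have "i \<noteq> (i + 3) mod n"
      using assms by (auto simp: mod_wrap)
    then show ?thesis
      using weave assms weave_mid_odd[of i n] by (simp add: weave_edge)
  qed auto
  then show "a < 2 * n" "m < 2 * n" "b < 2 * n" "even a" "even b" "a \<noteq> b" "m = a \<or> m = b \<or> odd m"
    by auto
qed

text \<open>Ensures that no two edges pass through the equator at the same non-vertex point.\<close>

lemma odd_mid_inj:
  assumes "4 \<le> n" "(a, m, b) \<in> all_edges n" "(a', m, b') \<in> all_edges n" "odd m"
  shows "(a, m, b) = (a', m, b')"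
proof -
  have *: "\<exists>i<n. (a, m, b) = weave n i" if "(a, m, b) \<in> all_edges n" for a b
    using that by (cases rule: all_edges_cases) (use assms(4) in auto)
  obtain i j where ij: "i < n" "(a, m, b) = weave n i" "j < n" "(a', m, b') = weave n j"
    using * assms by blast
  then have "i = j"
    using weave_mid_inj[of n i j] assms by (auto simp: weave_def)
  then show ?thesis
    using ij by simp
qed

text \<open>Parity decides: a chord of a woven edge has exactly one odd end, which determines the
  index, while a straight edge has two even ends in increasing order. Hence distinct edges never
  overlap along a chord.\<close>

lemma chord_inj:
  assumes n: "4 \<le> n" and E: "e \<in> all_edges n" "f \<in> all_edges n" and s: "s = 1 \<or> s = -1"
    and e: "chord s e = (p, q)" "p \<noteq> q" and f: "chord s f = (p', q')" "p' \<noteq> q'" and eq: "{p, q} = {p', q'}"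
  shows "e = f"
proof -
  have eq': "p = p' \<and> q = q' \<or> p = q' \<and> q = p'"
    using eq by (auto simp: doubleton_eq_iff)
  have weave_odd: "if s = 1 then even x \<and> y = (2 * j + 3) mod (2 * n) \<and> odd y
      else x = (2 * j + 3) mod (2 * n) \<and> odd x \<and> even y"
    if "chord s (weave n j) = (x, y)" for j x y
    using that weave_mid_odd[of j n] by (auto simp: weave_edge split: if_splits)
  have straight_even: "even x \<and> even y" if "g \<in> upper_edges n \<union> lower_edges n" "chord s g = (x, y)" for g x y
    using that by (auto simp: upper_edges_def lower_edges_def split: if_splits)
  show ?thesis
  proof (cases "e \<in> weave n ` {..<n}")
    case True
    then obtain i where i: "e = weave n i" "i < n"
      by auto
    have "f \<in> weave n ` {..<n}"
      using weave_odd[of i p q] e i straight_even[of f p' q'] f eq' E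
      unfolding all_edges_def by (auto split: if_splits)
    then obtain j where j: "f = weave n j" "j < n"
      by auto
    have "(2 * i + 3) mod (2 * n) = (2 * j + 3) mod (2 * n)"
      using weave_odd[of i p q] weave_odd[of j p' q'] e f i j eq' by (auto split: if_splits)
    then show ?thesis
      using weave_mid_inj[of n i j] n i j by simp
  next
    case False
    then have e': "e \<in> upper_edges n \<union> lower_edges n"
      using E unfolding all_edges_def by blast
    have "f \<notin> weave n ` {..<n}"
    proof
      assume "f \<in> weave n ` {..<n}"
      then obtain j where "f = weave n j"
        by auto
      then show False
        using weave_odd[of j p' q'] straight_even[OF e' e(1)] f eq' by (auto split: if_splits)
    qed
    then have "f \<in> upper_edges n \<union> lower_edges n"
      using E unfolding all_edges_def by blast
    moreover have "x < y \<and> g = (if s = 1 then (x, y, y) else (x, x, y))"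
      if "g \<in> upper_edges n \<union> lower_edges n" "chord s g = (x, y)" "x \<noteq> y" for g x y
      using that by (auto simp: upper_edges_def lower_edges_def split: if_splits)
    ultimately show ?thesis
      using e' e f eq' by (metis order_less_asym)
  qed
qed

section \<open>Reaching a vertex from a gap of the equator\<close>

lemma interleaved_separates:
  assumes "interleaved a b c d"
  shows "c < d \<Longrightarrow> c < a \<and> a < d \<or> c < b \<and> b < d" "c < d \<Longrightarrow> a < c \<or> d < a \<or> b < c \<or> d < b"
    and "d < c \<Longrightarrow> d < a \<and> a < c \<or> d < b \<and> b < c" "d < c \<Longrightarrow> a < d \<or> c < a \<or> b < d \<or> c < b"
  using assms by (auto simp: interleaved_def)

text \<open>Between the gap and a vertex next to it lies at most the odd position
  \<open>2 * i + 1\<close>. The last hypothesis says that no end of the chord is there or that the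
  vertex is on the same side of it as the gap.\<close>

lemma near_gap_not_interleaved:
  fixes n i a b c v :: nat
  assumes "4 \<le> n" "i < n" "c = 2 * i \<or> c = 2 * i + 1" "v = i \<or> v = (i + 1) mod n"
    and "a < 2 * n" "b < 2 * n" "(a \<noteq> 2 * i + 1 \<and> b \<noteq> 2 * i + 1) \<or> (c = 2 * i \<longleftrightarrow> v = i)"
  shows "\<not> interleaved (2 * a) (2 * b) (2 * c + 1) (4 * v)"
proof
  assume il: "interleaved (2 * a) (2 * b) (2 * c + 1) (4 * v)"
  have "(i + 1) mod n = (if i + 1 < n then i + 1 else 0)"
    using assms(2) by (cases "i + 1 = n") auto
  then consider "v = i" | "v = i + 1" | "v = 0" "i + 1 = n"
    using assms(2,4) by (metis Suc_eq_plus1 Suc_lessI)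
  then show False
  proof cases
    case 1
    then have "4 * v < 2 * c + 1"
      using assms by auto
    then have "4 * v < 2 * a \<and> 2 * a < 2 * c + 1 \<or> 4 * v < 2 * b \<and> 2 * b < 2 * c + 1"
      using interleaved_separates il by blast
    then show False
      using assms 1 by auto
  next
    case 2
    then have "2 * c + 1 < 4 * v"
      using assms by auto
    then have "2 * c + 1 < 2 * a \<and> 2 * a < 4 * v \<or> 2 * c + 1 < 2 * b \<and> 2 * b < 4 * v"
      using interleaved_separates il by blast
    then show False
      using assms 2 by auto
  next
    \<comment> \<open>Here the short arc passes the end of the numbering, so it is the outside of
      the interval that contains no end of the chord.\<close>
    case 3
    then have "4 * v < 2 * c + 1"
      by simp
    then have "2 * a < 4 * v \<or> 2 * c + 1 < 2 * a \<or> 2 * b < 4 * v \<or> 2 * c + 1 < 2 * b"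
      using interleaved_separates il by blast
    then show False
      using assms 3 by auto
  qed
qed

text \<open>Such a woven edge runs from vertex \<open>i - 1\<close> to vertex \<open>i + 2\<close>,
  taken cyclically; for \<open>n \<ge> 4\<close> these differ from \<open>i\<close> and
  \<open>i + 1\<close>.\<close>

lemma weave_mid_neighbours:
  fixes n i j :: nat
  assumes "4 \<le> n" "j < n" "(2 * j + 3) mod (2 * n) = 2 * i + 1"
  shows "i \<noteq> j" "i \<noteq> (j + 3) mod n" "(i + 1) mod n \<noteq> j" "(i + 1) mod n \<noteq> (j + 3) mod n"
  using assms by (auto simp: mod_wrap split: if_splits)

text \<open>
  The point \<open>y\<close> of the equator lies between the positions \<open>c\<close> and \<open>c + 1\<close> (cyclically). All positions are
  doubled here, so that \<open>y\<close> becomes \<open>2c + 1\<close> and vertex \<open>v\<close> becomes \<open>4v\<close>. The vertex \<open>w\<close> at \<open>c\<close> or \<open>c + 1\<close> works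
  unless it is a common end. Then no woven edge through the position between \<open>w\<close> and the next vertex \<open>w'\<close> on the
  other side of \<open>y\<close> is involved, and \<open>w'\<close> works unless it is a common end, too. In this last case \<open>n = 4\<close>, and one
  of the edges is woven and joins \<open>w\<close> to \<open>w'\<close> the long way round.
\<close>
lemma escape:
  assumes n: "4 \<le> n" and E: "e \<in> all_edges n" "f \<in> all_edges n" "e \<noteq> f" and c: "c < 2 * n"
  shows "\<exists>v<n. \<exists>s. (s = 1 \<or> s = -1) \<and> \<not> (2 * v \<in> edge_ends e \<and> 2 * v \<in> edge_ends f) \<and>
    (\<forall>g\<in>{e, f}. \<not> interleaved (2 * fst (chord s g)) (2 * snd (chord s g)) (2 * c + 1) (4 * v))"
proof -
  define i where "i = c div 2"
  have i: "i < n" "c = 2 * i \<or> c = 2 * i + 1"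
    using c by (auto simp: i_def)
  define i' where "i' = (i + 1) mod n"
  have i': "i' < n" "i \<noteq> i'"
    using n i by (auto simp: i'_def mod_wrap)
  have bd: "fst (chord s g) < 2 * n" "snd (chord s g) < 2 * n" if "g \<in> {e, f}" for s g
    using that E edge_wf[OF n] by (cases g; auto)+
  define w where "w = (if c = 2 * i then i else i')"
  define w' where "w' = (if c = 2 * i then i' else i)"
  have wn: "w < n" "w' < n"
    using i i' by (auto simp: w_def w'_def)
  consider "\<not> (2 * w \<in> edge_ends e \<and> 2 * w \<in> edge_ends f)"
    | "2 * w \<in> edge_ends e \<and> 2 * w \<in> edge_ends f" "\<not> (2 * w' \<in> edge_ends e \<and> 2 * w' \<in> edge_ends f)"
    | "2 * w \<in> edge_ends e \<and> 2 * w \<in> edge_ends f" "2 * w' \<in> edge_ends e \<and> 2 * w' \<in> edge_ends f"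
    by blast
  then show ?thesis
  proof cases
    case 1
    have "\<not> interleaved (2 * fst (chord 1 g)) (2 * snd (chord 1 g)) (2 * c + 1) (4 * w)" if "g \<in> {e, f}" for g
      by (rule near_gap_not_interleaved[OF n i]) (use bd[OF that] i' in \<open>auto simp: w_def i'_def\<close>)
    then show ?thesis
      using 1 wn by blast
  next
    case 2
    have "\<not> interleaved (2 * fst (chord 1 g)) (2 * snd (chord 1 g)) (2 * c + 1) (4 * w')" if g: "g \<in> {e, f}" for g
    proof (rule near_gap_not_interleaved[OF n i])
      have parity: "2 * x \<noteq> Suc (2 * y)" for x y :: nat
        by presburger
      have w: "2 * w \<in> edge_ends g" "w = i \<or> w = (i + 1) mod n"
        using 2 g by (auto simp: w_def i'_def)
      have "g \<in> all_edges n"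
        using E g by auto
      then have "fst (chord 1 g) \<noteq> 2 * i + 1 \<and> snd (chord 1 g) \<noteq> 2 * i + 1"
      proof (cases rule: all_edges_cases)
        case (weave j)
        then show ?thesis
          using weave_mid_neighbours[OF n \<open>j < n\<close>, of i] w parity by (auto simp: weave_edge)
      qed (auto simp: parity)
      then show "fst (chord 1 g) \<noteq> 2 * i + 1 \<and> snd (chord 1 g) \<noteq> 2 * i + 1 \<or> (c = 2 * i) = (w' = i)" ..
    qed (use bd[OF g] in \<open>auto simp: w'_def i'_def\<close>)
    then show ?thesis
      using 2 wn by blast
  next
    case 3
    have both: "edge_ends g \<supseteq> {2 * i, 2 * i'}" if "g \<in> {e, f}" for g
      using 3 that by (auto simp: w_def w'_def split: if_splits)
    \<comment> \<open>No lower edge joins cyclic neighbours, and a woven edge joins vertices three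
      apart, which are neighbours only for \<open>n = 4\<close>.\<close>
    have cases: "g = (2 * min i i', 2 * max i i', 2 * max i i') \<or> n = 4 \<and> g = weave n i'" if g: "g \<in> {e, f}" for g
    proof -
      have "g \<in> all_edges n" using g E by auto
      then show ?thesis
      proof (cases rule: all_edges_cases)
        case (upper x y)
        then show ?thesis
          using both[OF g] i' by (auto simp: min_def max_def)
      next
        case (lower x y)
        then have "i = x \<and> i' = y \<or> i = y \<and> i' = x"
          using both[OF g] i' by auto
        then show ?thesis
          using lower i n by (auto simp: i'_def mod_wrap split: if_splits)
      next
        case (weave j)
        then have "i = j \<and> i' = (j + 3) mod n \<or> i = (j + 3) mod n \<and> i' = j"
          using both[OF g] i' by (auto simp: weave_edge)
        then show ?thesis
          using weave i n by (auto simp: i'_def mod_wrap split: if_splits)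
      qed
    qed
    have n4: "n = 4" and wv: "weave n i' \<in> {e, f}"
      using cases[of e] cases[of f] E(3) by auto
    \<comment> \<open>In the lower hemisphere the cycle edge is degenerate, and the chord of the
      woven edge leaves this vertex on the same side as the gap.\<close>
    define v where "v = (i + 2) mod n"
    have i4: "i = 0 \<or> i = 1 \<or> i = 2 \<or> i = 3"
      using i n4 by auto
    have "2 * v \<notin> edge_ends (weave n i')"
      using i4 by (elim disjE) (simp_all add: weave_def n4 v_def i'_def)
    moreover have "\<not> interleaved (2 * fst (chord (-1) (weave n i'))) (2 * snd (chord (-1) (weave n i'))) (2 * c + 1) (4 * v)"
      using i4 i(2) by (elim disjE) (simp_all add: weave_def n4 v_def i'_def interleaved_def)
    moreover have "\<not> interleaved (2 * fst (chord (-1) g)) (2 * snd (chord (-1) g)) (2 * c + 1) (4 * v)"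
      if "g \<in> {e, f}" "g \<noteq> weave n i'" for g
      using cases[OF that(1)] that(2) by auto
    moreover have "v < n"
      using n by (simp add: v_def)
    ultimately show ?thesis
      using wv by blast
  qed
qed

section \<open>Counting the edges\<close>

lemma card_upper_edges:
  assumes "4 \<le> n"
  shows "finite (upper_edges n)" "card (upper_edges n) = 4 * n - 10"
proof -
  let ?h = "\<lambda>(i, j). (2 * i, 2 * j, 2 * j) :: edge"
  \<comment> \<open>Chords of length 1, of length 2, longer ones at \<open>0\<close>, and longer
    ones at \<open>n - 1\<close>; \<open>D\<close> starts at 1 because \<open>C\<close> already has
    the chord from \<open>0\<close> to \<open>n - 1\<close>.\<close>
  define A B C D where "A = (\<lambda>i. (i, i + 1)) ` {..<n - 1}" and "B = (\<lambda>i. (i, i + 2)) ` {..<n - 2}"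
    and "C = (\<lambda>j. (0::nat, j)) ` {3..<n}" and "D = (\<lambda>i. (i, n - 1)) ` {1..<n - 3}"
  have "upper_edges n = ?h ` (A \<union> B \<union> C \<union> D)"
  proof (intro equalityI subsetI)
    fix e assume "e \<in> upper_edges n"
    then obtain i j where e: "e = ?h (i, j)" "i < j" "j < n" "j \<le> i + 2 \<or> i = 0 \<or> j + 1 = n"
      unfolding upper_edges_def by auto
    then have "j = i + 1 \<and> i < n - 1 \<or> j = i + 2 \<and> i < n - 2 \<or> i = 0 \<and> j \<in> {3..<n} \<or> j = n - 1 \<and> i \<in> {1..<n - 3}"
      by auto
    then have "(i, j) \<in> A \<union> B \<union> C \<union> D"
      unfolding A_def B_def C_def D_def by blast
    then show "e \<in> ?h ` (A \<union> B \<union> C \<union> D)"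
      using e by blast
  next
    fix e assume "e \<in> ?h ` (A \<union> B \<union> C \<union> D)"
    then show "e \<in> upper_edges n"
      using assms unfolding A_def B_def C_def D_def upper_edges_def by (fastforce simp: less_diff_conv)
  qed
  moreover have "inj_on ?h X" for X
    by (auto simp: inj_on_def)
  moreover have fin: "finite A" "finite B" "finite C" "finite D"
    by (simp_all add: A_def B_def C_def D_def)
  moreover have "card (A \<union> B \<union> C \<union> D) = card A + card B + card C + card D"
  proof -
    have "A \<inter> B = {}" "(A \<union> B) \<inter> C = {}" "(A \<union> B \<union> C) \<inter> D = {}"
      using assms by (auto simp: A_def B_def C_def D_def)
    then show ?thesis
      using fin by (simp add: card_Un_disjoint)
  qed
  moreover have "card A = n - 1" "card B = n - 2" "card C = n - 3" "card D = n - 4"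
    unfolding A_def B_def C_def D_def by (simp_all add: card_image inj_on_def)
  ultimately show "finite (upper_edges n)" "card (upper_edges n) = 4 * n - 10"
    using assms by (simp_all add: card_image)
qed

lemma card_lower_edges:
  assumes "4 \<le> n"
  shows "finite (lower_edges n)" "card (lower_edges n) = 3 * n - 10"
proof -
  let ?h = "\<lambda>(i, j). (2 * i, 2 * i, 2 * j) :: edge"
  \<comment> \<open>Compared with the upper edges, the chords of length 1 are gone, and
    \<open>C\<close> stops before the closing edge to \<open>n - 1\<close>.\<close>
  define B C D where "B = (\<lambda>i. (i, i + 2)) ` {..<n - 2}"
    and "C = (\<lambda>j. (0::nat, j)) ` {3..<n - 1}" and "D = (\<lambda>i. (i, n - 1)) ` {1..<n - 3}"
  have "lower_edges n = ?h ` (B \<union> C \<union> D)"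
  proof (intro equalityI subsetI)
    fix e assume "e \<in> lower_edges n"
    then obtain i j where e: "e = ?h (i, j)" "i + 2 \<le> j" "j < n" "i \<noteq> 0 \<or> j + 1 \<noteq> n" "j = i + 2 \<or> i = 0 \<or> j + 1 = n"
      unfolding lower_edges_def by auto
    then have "j = i + 2 \<and> i < n - 2 \<or> i = 0 \<and> j \<in> {3..<n - 1} \<or> j = n - 1 \<and> i \<in> {1..<n - 3}"
      by auto
    then have "(i, j) \<in> B \<union> C \<union> D"
      unfolding B_def C_def D_def by blast
    then show "e \<in> ?h ` (B \<union> C \<union> D)"
      using e by blast
  next
    fix e assume "e \<in> ?h ` (B \<union> C \<union> D)"
    then show "e \<in> lower_edges n"
      using assms unfolding B_def C_def D_def lower_edges_def by (fastforce simp: less_diff_conv)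
  qed
  moreover have "inj_on ?h X" for X
    by (auto simp: inj_on_def)
  moreover have fin: "finite B" "finite C" "finite D"
    by (simp_all add: B_def C_def D_def)
  moreover have "card (B \<union> C \<union> D) = card B + card C + card D"
  proof -
    have "B \<inter> C = {}" "(B \<union> C) \<inter> D = {}"
      using assms by (auto simp: B_def C_def D_def)
    then show ?thesis
      using fin by (simp add: card_Un_disjoint)
  qed
  moreover have "card B = n - 2" "card C = n - 4" "card D = n - 4"
    unfolding B_def C_def D_def by (simp_all add: card_image inj_on_def)
  ultimately show "finite (lower_edges n)" "card (lower_edges n) = 3 * n - 10"
    using assms by (simp_all add: card_image)
qed

lemma card_all_edges:
  assumes "4 \<le> n"
  shows "finite (all_edges n)" "card (all_edges n) = 8 * n - 20"
proof -
  have "inj_on (weave n) {..<n}"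
    by (auto simp: inj_on_def weave_def)
  then have W: "card (weave n ` {..<n}) = n"
    by (simp add: card_image)
  have odd: "odd (fst (snd e))" if "e \<in> weave n ` {..<n}" for e
    using that weave_mid_odd by (auto simp: weave_def)
  have even: "even (fst (snd e))" if "e \<in> upper_edges n \<union> lower_edges n" for e
    using that by (auto simp: upper_edges_def lower_edges_def)
  have 1: "(upper_edges n \<union> lower_edges n) \<inter> weave n ` {..<n} = {}"
    using odd even by blast
  have 2: "upper_edges n \<inter> lower_edges n = {}"
    by (auto simp: upper_edges_def lower_edges_def)
  show "finite (all_edges n)"
    using card_upper_edges card_lower_edges assms by (simp add: all_edges_def)
  show "card (all_edges n) = 8 * n - 20"
    using card_upper_edges card_lower_edges assms W 1 2
    by (simp add: all_edges_def card_Un_disjoint)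
qed

subsection \<open>The drawing\<close>

definition node :: "nat \<Rightarrow> real^3" where
  "node c = hemi 1 (pt (real c))"

definition leg :: "real \<Rightarrow> nat \<Rightarrow> nat \<Rightarrow> real \<Rightarrow> real^3" where
  "leg s p q = hemi s \<circ> linepath (pt (real p)) (pt (real q))"

text \<open>A degenerate leg is dropped, since a constant piece would destroy injectivity.\<close>

fun edge_path :: "edge \<Rightarrow> real \<Rightarrow> real^3" where
  "edge_path (a, m, b) =
     (if m = b then leg 1 a m else if m = a then leg (-1) m b else leg 1 a m +++ leg (-1) m b)"

definition disc_chord :: "real \<Rightarrow> edge \<Rightarrow> (real^2) set" where
  "disc_chord s e = closed_segment (pt (real (fst (chord s e)))) (pt (real (snd (chord s e))))"

lemma inj_hemi: "inj_on (hemi s) A"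
  by (metis inj_on_inverseI shadow_hemi)

lemma arc_leg: "p \<noteq> q \<Longrightarrow> arc (leg s p q)"
  unfolding leg_def arc_def
  using arc_linepath[of "pt (real p)" "pt (real q)"]
  by (auto simp: arc_def comp_inj_on inj_hemi intro!: path_continuous_image continuous_on_hemi)

lemma path_image_leg: "path_image (leg s p q) = hemi s ` closed_segment (pt (real p)) (pt (real q))"
  by (simp add: leg_def path_image_compose)

lemma leg_ends [simp]: "pathstart (leg s p q) = node p" "pathfinish (leg s p q) = node q"
  by (simp_all add: leg_def node_def pathstart_compose pathfinish_compose hemi_circle[of _ s 1])

lemma path_image_leg_refl: "path_image (leg s p p) = {node p}"
  by (simp add: path_image_leg node_def hemi_circle[of _ s 1])

lemma node_in_leg: "node p \<in> path_image (leg s p q)" "node q \<in> path_image (leg s p q)"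
  using pathstart_in_path_image[of "leg s p q"] pathfinish_in_path_image[of "leg s p q"] by simp_all

lemma edge_path_ends [simp]:
  "pathstart (edge_path e) = node (fst e)" "pathfinish (edge_path e) = node (snd (snd e))"
  by (cases e; simp)+

text \<open>This holds uniformly for straight and woven edges: a degenerate chord adds only an end
  of the other leg.\<close>

lemma path_image_edge:
  "path_image (edge_path e) = hemi 1 ` disc_chord 1 e \<union> hemi (-1) ` disc_chord (-1) e"
proof (cases e)
  case (fields a m b)
  then show ?thesis
    using node_in_leg(2)[of b 1 a] node_in_leg(1)[of a "-1" b]
    by (auto simp: disc_chord_def path_image_join path_image_leg_refl simp flip: path_image_leg)
qed

lemma hemi_in_edge_path:
  assumes "norm x < 1" "s = 1 \<or> s = -1"
  shows "hemi s x \<in> path_image (edge_path e) \<longleftrightarrow> x \<in> disc_chord s e"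
proof -
  have "hemi s x \<noteq> hemi (- s) y" for y
    using hemi_opposite[of s x y] assms by auto
  moreover have "hemi s x = hemi s y \<longleftrightarrow> x = y" for y
    by (metis shadow_hemi)
  ultimately show ?thesis
    using assms(2) unfolding path_image_edge by auto (metis minus_minus)+
qed

lemma disc_chord_on_circle:
  assumes "x \<in> disc_chord s (a, m, b)" "norm x = 1"
  shows "x = pt (real a) \<or> x = pt (real m) \<or> x = pt (real b)"
  using assms segment_on_circle unfolding disc_chord_def by (cases "s = 1") fastforce+

lemma disc_chord_in_disc: "x \<in> disc_chord s e \<Longrightarrow> norm x \<le> 1"
  unfolding disc_chord_def by (rule segment_in_disc)

lemma equator_in_edge_path:
  assumes "hemi s x \<in> path_image (edge_path (a, m, b))" "norm x = 1"
  shows "x = pt (real a) \<or> x = pt (real m) \<or> x = pt (real b)"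
proof -
  obtain s' y where "y \<in> disc_chord s' (a, m, b)" "hemi s x = hemi s' y"
    using assms(1) unfolding path_image_edge by blast
  moreover from this have "x = y"
    by (metis shadow_hemi)
  ultimately show ?thesis
    using disc_chord_on_circle assms(2) by blast
qed

lemma edge_path_point:
  assumes "z \<in> path_image (edge_path e)"
  obtains s x where "s = 1 \<or> s = -1" "x \<in> disc_chord s e" "z = hemi s x"
  using assms unfolding path_image_edge by blast

lemma disc_chord_line:
  assumes "norm x < 1" "x \<in> disc_chord s e"
  shows "fst (chord s e) \<noteq> snd (chord s e)"
  using assms by (auto simp: disc_chord_def)

lemma disc_chord_eq_line:
  assumes "norm x < 1" "fst (chord s e) \<noteq> snd (chord s e)"
  shows "x \<in> disc_chord s e \<longleftrightarrow> orient (pt (real (fst (chord s e)))) (pt (real (snd (chord s e)))) x = 0"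
  using assms unfolding disc_chord_def by (auto intro: disc_line_segment dest: orient_segment)

lemma edge_path_in_S2: "path_image (edge_path e) \<subseteq> S2"
  unfolding path_image_edge by (intro Un_least image_subsetI hemi_in_S2 disc_chord_in_disc) auto

text \<open>The two legs can meet only on the equator, where each has just its ends;
  \<open>a \<noteq> b\<close> leaves the middle as the only common one.\<close>

lemma arc_edge_path:
  assumes "a \<noteq> b"
  shows "arc (edge_path (a, m, b))"
proof (cases "m = a \<or> m = b")
  case True
  then show ?thesis
    using assms by (auto intro: arc_leg)
next
  case False
  have "path_image (leg 1 a m) \<inter> path_image (leg (-1) m b) \<subseteq> {node m}"
  proof
    fix z assume "z \<in> path_image (leg 1 a m) \<inter> path_image (leg (-1) m b)"
    then obtain x y where xy: "z = hemi 1 x" "x \<in> closed_segment (pt (real a)) (pt (real m))"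
        "z = hemi (-1) y" "y \<in> closed_segment (pt (real m)) (pt (real b))"
      unfolding path_image_leg by blast
    then have "x = y" "norm x = 1"
      using hemi_opposite[of 1 x y] segment_in_disc[OF xy(2)] by auto
    then have "x = pt (real m)"
      using segment_on_circle[OF xy(2)] segment_on_circle[OF xy(4)] assms by auto
    then show "z \<in> {node m}"
      using xy(1) by (simp add: node_def)
  qed
  then show ?thesis
    using False by (auto intro!: arc_join arc_leg)
qed

declare edge_path.simps [simp del]

lemma node_eq_iff [simp]: "node c = node d \<longleftrightarrow> c = d"
  unfolding node_def by (metis pt_eq_iff shadow_hemi of_nat_eq_iff)

lemma arc_interior_eq:
  assumes "arc g"
  shows "arc_interior g = path_image g - {pathstart g, pathfinish g}"
proof -
  have "{0..1} = insert 0 (insert 1 {0<..<1::real})"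
    by auto
  moreover have "inj_on g {0..1}"
    using assms by (simp add: arc_def)
  ultimately show ?thesis
    unfolding arc_interior_def path_image_def pathstart_def pathfinish_def
    by (auto simp: inj_on_def)
qed

section \<open>Intersections of drawn edges\<close>

locale weave_drawing =
  fixes n :: nat
  assumes n: "4 \<le> n"
begin

lemma arc_edge: "e \<in> all_edges n \<Longrightarrow> arc (edge_path e)"
  using edge_wf[OF n] by (cases e) (metis arc_edge_path)

lemma edge_interior:
  assumes "e \<in> all_edges n"
  shows "arc_interior (edge_path e) = path_image (edge_path e) - {node (fst e), node (snd (snd e))}"
  using arc_interior_eq[OF arc_edge[OF assms]] by simp

lemma node_on_edge:
  assumes "e \<in> all_edges n" "node (2 * v) \<in> path_image (edge_path e)"
  shows "2 * v \<in> edge_ends e"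
proof -
  obtain a m b where e: "e = (a, m, b)"
    by (cases e)
  have "pt (real (2 * v)) = pt (real a) \<or> pt (real (2 * v)) = pt (real m) \<or> pt (real (2 * v)) = pt (real b)"
    using equator_in_edge_path[of 1 "pt (real (2 * v))" a m b] assms(2) by (simp add: e node_def)
  then have "2 * v = a \<or> 2 * v = m \<or> 2 * v = b"
    unfolding pt_eq_iff of_nat_eq_iff .
  moreover have "m = a \<or> m = b \<or> odd m"
    using edge_wf(7)[OF n assms(1)[unfolded e]] .
  ultimately show ?thesis
    by (auto simp: e)
qed

text \<open>Crossings avoid the equator: a common interior point there would be the middle of both
  edges, and an odd middle determines its edge.\<close>

lemma crossing_point:
  assumes E: "e \<in> all_edges n" "f \<in> all_edges n" "e \<noteq> f"
    and z: "z \<in> arc_interior (edge_path e)" "z \<in> arc_interior (edge_path f)"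
  obtains s x where "s = 1 \<or> s = -1" "norm x < 1" "z = hemi s x" "x \<in> disc_chord s e" "x \<in> disc_chord s f"
proof -
  obtain a m b where e: "e = (a, m, b)"
    by (cases e)
  obtain a' m' b' where f: "f = (a', m', b')"
    by (cases f)
  have ze: "z \<in> path_image (edge_path e)" "z \<noteq> node a" "z \<noteq> node b"
   and zf: "z \<in> path_image (edge_path f)" "z \<noteq> node a'" "z \<noteq> node b'"
    using z edge_interior E by (auto simp: e f)
  obtain s x where sx: "s = 1 \<or> s = -1" "x \<in> disc_chord s e" "z = hemi s x"
    using ze(1) by (rule edge_path_point)
  have "norm x \<noteq> 1"
  proof
    assume x: "norm x = 1"
    have z1: "z = hemi 1 x"
      using sx(3) hemi_circle[OF x, of s 1] by simp
    have "x = pt (real m)" "x = pt (real m')"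
      using equator_in_edge_path[of s x] ze zf x z1 sx(3) unfolding e f node_def by auto
    then have "m = m'"
      by simp
    moreover have "m \<noteq> a" "m \<noteq> b"
      using ze(2,3) z1 \<open>x = pt (real m)\<close> by (auto simp: node_def)
    then have "odd m"
      using edge_wf(7)[OF n E(1)[unfolded e]] by blast
    ultimately show False
      using odd_mid_inj[OF n] E unfolding e f by blast
  qed
  then have "norm x < 1"
    using disc_chord_in_disc[OF sx(2)] by simp
  then show ?thesis
    using that[of s x] sx hemi_in_edge_path[of x s f] zf(1) by blast
qed

lemma chords_distinct:
  assumes E: "e \<in> all_edges n" "f \<in> all_edges n" "e \<noteq> f" and s: "s = 1 \<or> s = -1"
    and nd: "fst (chord s e) \<noteq> snd (chord s e)" "fst (chord s f) \<noteq> snd (chord s f)"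
  shows "{real (fst (chord s e)), real (snd (chord s e))} \<noteq> {real (fst (chord s f)), real (snd (chord s f))}"
proof
  assume "{real (fst (chord s e)), real (snd (chord s e))} = {real (fst (chord s f)), real (snd (chord s f))}"
  then have "{fst (chord s e), snd (chord s e)} = {fst (chord s f), snd (chord s f)}"
    by (auto simp: doubleton_eq_iff)
  then show False
    using chord_inj[OF n E(1,2) s, of "fst (chord s e)" "snd (chord s e)" "fst (chord s f)" "snd (chord s f)"] nd E(3)
    by (simp add: prod_eq_iff)
qed

lemma interleaved_real: "interleaved (real a) (real b) (real c) (real d) \<longleftrightarrow> interleaved a b c d"
  by (simp add: interleaved_def)

text \<open>Passes from geometry to combinatorics: chords that are not interleaved could meet only
  at an end, but the crossing lies inside the disc.\<close>

lemma crossing_point_crosses: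
  assumes E: "e \<in> all_edges n" "f \<in> all_edges n" "e \<noteq> f"
    and z: "z \<in> arc_interior (edge_path e)" "z \<in> arc_interior (edge_path f)"
  shows "crosses e f"
proof -
  obtain s x where x: "s = 1 \<or> s = -1" "norm x < 1" "x \<in> disc_chord s e" "x \<in> disc_chord s f"
    using crossing_point[OF E z] by metis
  have "cross_on s e f"
  proof (rule ccontr)
    assume "\<not> cross_on s e f"
    then have "x = pt (real (fst (chord s f))) \<or> x = pt (real (snd (chord s f)))"
      using x disc_chord_line[OF x(2)] chords_distinct[OF E x(1)]
      by (intro segments_meet[of x "real (fst (chord s e))" "real (snd (chord s e))"])
        (auto simp: disc_chord_def interleaved_real)
    then show False
      using x(2) by auto
  qed
  then show ?thesis
    using x(1) unfolding crosses_def by blast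
qed

lemma crossing_point_proper:
  assumes E: "e \<in> all_edges n" "f \<in> all_edges n" "e \<noteq> f"
    and z: "z \<in> arc_interior (edge_path e)" "z \<in> arc_interior (edge_path f)"
  shows "proper_crossing (edge_path e) (edge_path f) z"
proof -
  obtain s x where x: "s = 1 \<or> s = -1" "norm x < 1" "z = hemi s x" "x \<in> disc_chord s e" "x \<in> disc_chord s f"
    using crossing_point[OF E z] by metis
  note nd = disc_chord_line[OF x(2) x(4)] disc_chord_line[OF x(2) x(5)]
  show ?thesis
    unfolding x(3)
  proof (rule proper_crossing_hemi[OF _ x(2) _ _ chords_distinct[OF E x(1) nd]])
    show "orient (pt (real (fst (chord s e)))) (pt (real (snd (chord s e)))) x = 0"
      using disc_chord_eq_line[OF x(2) nd(1)] x(4) by blast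
    show "orient (pt (real (fst (chord s f)))) (pt (real (snd (chord s f)))) x = 0"
      using disc_chord_eq_line[OF x(2) nd(2)] x(5) by blast
    show "hemi s y \<in> path_image (edge_path e)
        \<longleftrightarrow> orient (pt (real (fst (chord s e)))) (pt (real (snd (chord s e)))) y = 0" if "norm y < 1" for y
      using hemi_in_edge_path[OF that x(1)] disc_chord_eq_line[OF that nd(1)] by blast
    show "hemi s y \<in> path_image (edge_path f)
        \<longleftrightarrow> orient (pt (real (fst (chord s f)))) (pt (real (snd (chord s f)))) y = 0" if "norm y < 1" for y
      using hemi_in_edge_path[OF that x(1)] disc_chord_eq_line[OF that nd(2)] by blast
  qed (use x(1) nd in auto)
qed

lemma finite_disc_chord_Int:
  assumes E: "e \<in> all_edges n" "f \<in> all_edges n" "e \<noteq> f" and s: "s = 1 \<or> s = -1"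
  shows "finite (disc_chord s e \<inter> disc_chord s f)"
proof (cases "fst (chord s e) = snd (chord s e) \<or> fst (chord s f) = snd (chord s f)")
  case True
  then show ?thesis
    by (auto simp: disc_chord_def)
next
  case False
  define p q c d where "p = real (fst (chord s e))" and "q = real (snd (chord s e))"
    and "c = real (fst (chord s f))" and "d = real (snd (chord s f))"
  have ne: "p \<noteq> q" "c \<noteq> d" "{p, q} \<noteq> {c, d}"
    using False chords_distinct[OF E s] by (auto simp: p_def q_def c_def d_def)
  let ?L = "orient (pt p) (pt q)"
  \<comment> \<open>The parameter at which the affine function \<open>?L\<close> vanishes along the
    second chord.\<close>
  define u0 where "u0 = ?L (pt c) / (?L (pt c) - ?L (pt d))"
  have "x = (1 - u0) *\<^sub>R pt c + u0 *\<^sub>R pt d" if x: "x \<in> disc_chord s e" "x \<in> disc_chord s f" for x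
  proof -
    obtain u where u: "x = (1 - u) *\<^sub>R pt c + u *\<^sub>R pt d"
      using x(2) by (auto simp: disc_chord_def closed_segment_def c_def d_def)
    have z: "(1 - u) * ?L (pt c) + u * ?L (pt d) = 0"
      using orient_segment[of x "pt p" "pt q"] x(1) by (simp add: u orient_affine disc_chord_def p_def q_def)
    have nz: "?L (pt c) \<noteq> 0 \<or> ?L (pt d) \<noteq> 0"
      using ne by (auto simp: orient_pt_eq_0_iff)
    have "?L (pt c) \<noteq> ?L (pt d)"
      using z nz by (auto simp: algebra_simps)
    then have "u = u0"
      using z by (simp add: u0_def field_simps)
    then show ?thesis
      by (simp add: u)
  qed
  then have "disc_chord s e \<inter> disc_chord s f \<subseteq> {(1 - u0) *\<^sub>R pt c + u0 *\<^sub>R pt d}"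
    by blast
  then show ?thesis
    by (rule finite_subset) simp
qed

lemma finite_edges_Int:
  assumes E: "e \<in> all_edges n" "f \<in> all_edges n" "e \<noteq> f"
  shows "finite (path_image (edge_path e) \<inter> path_image (edge_path f))"
proof -
  obtain a m b where e: "e = (a, m, b)"
    by (cases e)
  have "path_image (edge_path e) \<inter> path_image (edge_path f)
      \<subseteq> hemi 1 ` (disc_chord 1 e \<inter> disc_chord 1 f) \<union> hemi (-1) ` (disc_chord (-1) e \<inter> disc_chord (-1) f) \<union> node ` {a, m, b}"
  proof
    fix z assume z: "z \<in> path_image (edge_path e) \<inter> path_image (edge_path f)"
    then obtain s x where sx: "s = 1 \<or> s = -1" "x \<in> disc_chord s e" "z = hemi s x"
      using edge_path_point by blast
    show "z \<in> hemi 1 ` (disc_chord 1 e \<inter> disc_chord 1 f) \<union> hemi (-1) ` (disc_chord (-1) e \<inter> disc_chord (-1) f) \<union> node ` {a, m, b}"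
    proof (cases "norm x = 1")
      case True
      then have "z \<in> node ` {a, m, b}"
        using disc_chord_on_circle[of x s a m b] sx hemi_circle[OF True, of s 1] by (auto simp: e node_def)
      then show ?thesis by blast
    next
      case False
      then have "norm x < 1"
        using disc_chord_in_disc[OF sx(2)] by simp
      then have "x \<in> disc_chord s f"
        using hemi_in_edge_path[of x s f] sx z by blast
      then show ?thesis
        using sx by blast
    qed
  qed
  then show ?thesis
    by (rule finite_subset) (simp add: finite_disc_chord_Int[OF E])
qed

end

section \<open>Lenses and their regions\<close>

lemma arc_end_in_subpath:
  assumes "arc g" "0 \<le> a" "a < b" "b \<le> 1" "x \<in> path_image (subpath a b g)"
    and "x = pathstart g \<or> x = pathfinish g"
  shows "x = pathstart (subpath a b g) \<or> x = pathfinish (subpath a b g)"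
proof -
  obtain t where t: "a \<le> t" "t \<le> b" "x = g t"
    using assms by (auto simp: path_image_subpath)
  have "inj_on g {0..1}"
    using assms by (simp add: arc_def)
  then have "t = 0 \<or> t = 1"
    using assms t by (auto simp: pathstart_def pathfinish_def inj_on_def)
  then show ?thesis
    using assms t by auto
qed

text \<open>\<open>nonhomotopic_drawing\<close> also admits \<open>e = f\<close>. Equal ends then
  force equal parts of the arc, whose middle is a further common point.\<close>

lemma arc_no_self_lens:
  assumes "arc g" "0 \<le> a" "a < b" "b \<le> 1" "0 \<le> c" "c < d" "d \<le> 1"
    and ends: "{pathstart (subpath a b g), pathfinish (subpath a b g)} = {pathstart (subpath c d g), pathfinish (subpath c d g)}"
  shows "path_image (subpath a b g) \<inter> path_image (subpath c d g) \<noteq> {pathstart (subpath a b g), pathfinish (subpath a b g)}"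
proof
  assume eq: "path_image (subpath a b g) \<inter> path_image (subpath c d g) = {pathstart (subpath a b g), pathfinish (subpath a b g)}"
  have inj: "inj_on g {0..1}"
    using assms by (simp add: arc_def)
  have "g ` {a, b} = g ` {c, d}"
    using ends by simp
  then have "{a, b} = {c, d}"
    using inj_on_image_eq_iff[OF inj, of "{a, b}" "{c, d}"] assms by auto
  then have cd: "c = a" "d = b"
    using assms by (auto simp: doubleton_eq_iff)
  have "g ((a + b) / 2) \<in> path_image (subpath a b g)"
    using assms by (simp add: path_image_subpath)
  then have "g ((a + b) / 2) = g a \<or> g ((a + b) / 2) = g b"
    using eq cd by auto
  then have "(a + b) / 2 = a \<or> (a + b) / 2 = b"
    using inj assms by (auto dest!: inj_onD)
  then show False
    using assms by auto
qed

lemma segment_in_line: "\<exists>k c. k \<noteq> 0 \<and> (\<forall>x\<in>closed_segment p q. k \<bullet> x = c)" for p q :: "real^2"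
proof (cases "p = q")
  case True
  have "vector [1, 0] \<noteq> (0 :: real^2)"
    by (simp add: vec_eq_iff forall_2)
  then show ?thesis
    using True by auto
next
  case False
  define k :: "real^2" where "k = vector [p$2 - q$2, q$1 - p$1]"
  have "k \<noteq> 0"
    using False by (auto simp: k_def vec_eq_iff forall_2)
  moreover have "k \<bullet> q = k \<bullet> p"
    by (simp add: k_def inner_vec_def sum_2 algebra_simps)
  then have "\<forall>x\<in>closed_segment p q. k \<bullet> x = k \<bullet> p"
    by (auto simp: closed_segment_def inner_add_right) (simp add: algebra_simps)
  ultimately show ?thesis
    by blast
qed

text \<open>Interleaving depends only on the order, so \<open>t\<close> may be replaced by the
  midpoint of its gap; doubling keeps the positions integral.\<close>

lemma gap_position:
  assumes "\<And>c. c < 2 * n \<Longrightarrow> t \<noteq> real c" "0 < n"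
  obtains c where "c < 2 * n"
    "\<And>a b v. a < 2 * n \<Longrightarrow> b < 2 * n \<Longrightarrow> v < n \<Longrightarrow>
       interleaved (real a) (real b) t (real (2 * v)) \<longleftrightarrow> interleaved (2 * a) (2 * b) (2 * c + 1) (4 * v)"
proof (cases "0 < t \<and> t < real (2 * n)")
  case True
  define c where "c = nat \<lfloor>t\<rfloor>"
  have c: "real c \<le> t" "t < real c + 1"
    using True by (auto simp: c_def)
  then have cn: "c < 2 * n"
    using True by linarith
  have lt: "real x < t \<longleftrightarrow> 2 * x < 2 * c + 1" "t < real x \<longleftrightarrow> 2 * c + 1 < 2 * x" if "x < 2 * n" for x
  proof -
    have "x \<le> c \<and> real x < t \<or> c + 1 \<le> x \<and> t < real x"
    proof (cases "x \<le> c")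
      case True
      then have "real x \<le> t"
        using c by linarith
      then show ?thesis
        using True assms(1)[OF that] by auto
    next
      case False
      then have "real c + 1 \<le> real x"
        by linarith
      then show ?thesis
        using False c by auto
    qed
    then show "real x < t \<longleftrightarrow> 2 * x < 2 * c + 1" "t < real x \<longleftrightarrow> 2 * c + 1 < 2 * x"
      by auto
  qed
  show ?thesis
  proof (rule that[OF cn])
    fix a b v assume "a < 2 * n" "b < 2 * n" "v < n"
    then show "interleaved (real a) (real b) t (real (2 * v)) \<longleftrightarrow> interleaved (2 * a) (2 * b) (2 * c + 1) (4 * v)"
      using lt[of a] lt[of b] unfolding interleaved_def by (simp del: of_nat_mult)
  qed
next
  case False
  \<comment> \<open>Parameters below or above all positions lie in the same cyclic gap, the one
    after position \<open>2 * n - 1\<close>.\<close>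
  then have below_or_above: "(\<forall>x<2 * n. t < real x) \<or> (\<forall>x<2 * n. real x < t)"
    using assms(1)[of 0] assms(2) by force
  show ?thesis
  proof (rule that[of "2 * n - 1"])
    fix a b v assume "a < 2 * n" "b < 2 * n" "v < n"
    then have "t < real a \<and> t < real b \<or> real a < t \<and> real b < t"
      using below_or_above by blast
    then have "interleaved (real a) (real b) t (real (2 * v)) \<longleftrightarrow>
        a < 2 * v \<and> 2 * v < b \<or> b < 2 * v \<and> 2 * v < a"
      unfolding interleaved_def by (auto simp del: of_nat_mult)
    also have "\<dots> \<longleftrightarrow> interleaved (2 * a) (2 * b) (2 * (2 * n - 1) + 1) (4 * v)"
    proof -
      have "2 * a < 2 * (2 * n - 1) + 1" "2 * b < 2 * (2 * n - 1) + 1"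
        using \<open>a < 2 * n\<close> \<open>b < 2 * n\<close> by linarith+
      then show ?thesis
        unfolding interleaved_def by auto
    qed
    finally show "interleaved (real a) (real b) t (real (2 * v)) \<longleftrightarrow>
        interleaved (2 * a) (2 * b) (2 * (2 * n - 1) + 1) (4 * v)" .
  qed (use assms in auto)
qed

context weave_drawing
begin

lemma lens_region_contains_vertex:
  assumes E: "e \<in> all_edges n" "f \<in> all_edges n"
    and ab: "0 \<le> a" "a < b" "b \<le> 1" and cd: "0 \<le> c" "c < d" "d \<le> 1"
    and \<alpha>: "\<alpha> = subpath a b (edge_path e)" and \<beta>: "\<beta> = subpath c d (edge_path f)"
    and ends: "{pathstart \<alpha>, pathfinish \<alpha>} = {pathstart \<beta>, pathfinish \<beta>}"
    and meet: "path_image \<alpha> \<inter> path_image \<beta> = {pathstart \<alpha>, pathfinish \<alpha>}"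
    and R: "R \<in> components (S2 - (path_image \<alpha> \<union> path_image \<beta>))"
  shows "\<exists>v<n. node (2 * v) \<in> R"
proof -
  define C where "C = path_image \<alpha> \<union> path_image \<beta>"
  have R: "R \<in> components (S2 - C)"
    using R by (simp add: C_def)
  have ef: "e \<noteq> f"
    using arc_no_self_lens[OF arc_edge[OF E(1)] ab cd] ends meet \<alpha> \<beta> by blast
  have paths: "path \<alpha>" "path \<beta>"
    using arc_edge E ab cd by (auto simp: \<alpha> \<beta> arc_imp_path intro!: path_subpath)
  then have closedC: "closed C"
    unfolding C_def by (intro closed_Un compact_imp_closed compact_path_image)
  have sub: "path_image \<alpha> \<subseteq> path_image (edge_path e)" "path_image \<beta> \<subseteq> path_image (edge_path f)"
    using ab cd unfolding \<alpha> \<beta> by (intro path_image_subpath_subset; simp)+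
  have onC: "\<exists>g\<in>{e, f}. z \<in> path_image (edge_path g)" if "z \<in> C" for z
    using that sub by (auto simp: C_def)
  \<comment> \<open>A vertex on the lens boundary is an end of its edge, hence an end of that part
    of the edge, hence on both parts.\<close>
  have common: "2 * v \<in> edge_ends e \<and> 2 * v \<in> edge_ends f" if v: "node (2 * v) \<in> C" for v
  proof -
    have ends_node: "node (2 * v) = pathstart (edge_path g) \<or> node (2 * v) = pathfinish (edge_path g)"
      if "2 * v \<in> edge_ends g" for g
      using that by (cases g) auto
    have "node (2 * v) \<in> path_image \<alpha> \<and> node (2 * v) \<in> path_image \<beta>"
    proof (cases "node (2 * v) \<in> path_image \<alpha>")
      case True
      then have "2 * v \<in> edge_ends e"
        using node_on_edge E sub by blast
      then have "node (2 * v) \<in> {pathstart \<alpha>, pathfinish \<alpha>}"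
        using arc_end_in_subpath[OF arc_edge[OF E(1)] ab] True ends_node unfolding \<alpha> by blast
      then show ?thesis
        using meet by blast
    next
      case False
      then have "node (2 * v) \<in> path_image \<beta>"
        using v by (simp add: C_def)
      moreover from this have "2 * v \<in> edge_ends f"
        using node_on_edge E sub by blast
      ultimately have "node (2 * v) \<in> {pathstart \<beta>, pathfinish \<beta>}"
        using arc_end_in_subpath[OF arc_edge[OF E(2)] cd] ends_node unfolding \<beta> by blast
      then show ?thesis
        using meet ends by blast
    qed
    then show ?thesis
      using node_on_edge E sub by blast
  qed
  \<comment> \<open>Avoiding \<open>F\<close> makes the point found on the equator of the form
    \<open>pt t\<close>, with \<open>t\<close> strictly between positions.\<close>
  define F where "F = insert (vector [-1, 0]) (pt ` real ` {..<2 * n})"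
  obtain x where x: "norm x = 1" "x \<notin> F" "hemi 1 x \<in> R"
  proof (rule component_reaches_equator[OF R closedC, of F])
    show "finite F"
      by (simp add: F_def)
    fix s :: real assume "s\<^sup>2 = 1"
    then have s: "s = 1 \<or> s = -1"
      by (simp add: power2_eq_1_iff)
    obtain k1 c1 where k1: "k1 \<noteq> 0" "\<forall>x\<in>disc_chord s e. k1 \<bullet> x = c1"
      unfolding disc_chord_def using segment_in_line by blast
    obtain k2 c2 where k2: "k2 \<noteq> 0" "\<forall>x\<in>disc_chord s f. k2 \<bullet> x = c2"
      unfolding disc_chord_def using segment_in_line by blast
    have "k1 \<bullet> x = c1 \<or> k2 \<bullet> x = c2" if "norm x < 1" "hemi s x \<in> C" for x
      using onC[OF that(2)] hemi_in_edge_path[OF that(1) s] k1 k2 by auto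
    then show "\<exists>n1 c1 n2 c2. n1 \<noteq> (0 :: real^2) \<and> n2 \<noteq> (0 :: real^2) \<and>
         (\<forall>x. norm x < 1 \<and> hemi s x \<in> C \<longrightarrow> n1 \<bullet> x = c1 \<or> n2 \<bullet> x = c2)"
      using k1(1) k2(1) by (intro exI[of _ k1] exI[of _ c1] exI[of _ k2] exI[of _ c2]) simp
  next
    fix x assume x: "norm (x :: real^2) = 1" "hemi 1 x \<in> C"
    then obtain g where g: "g \<in> {e, f}" "hemi 1 x \<in> path_image (edge_path g)"
      using onC by blast
    obtain p m q where g3: "g = (p, m, q)"
      by (cases g)
    have "x = pt (real p) \<or> x = pt (real m) \<or> x = pt (real q)"
      using equator_in_edge_path g x unfolding g3 by blast
    moreover have "p < 2 * n" "m < 2 * n" "q < 2 * n"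
      using edge_wf[OF n, of p m q] g E unfolding g3 by auto
    ultimately show "x \<in> F"
      unfolding F_def by blast
  qed
  obtain t where t: "x = pt t"
    using circle_eq_pt x unfolding F_def by blast
  have t_free: "t \<noteq> real c" if "c < 2 * n" for c
    using x(2) that unfolding F_def t by blast
  obtain c where c: "c < 2 * n" "\<And>a b v. a < 2 * n \<Longrightarrow> b < 2 * n \<Longrightarrow> v < n \<Longrightarrow>
       interleaved (real a) (real b) t (real (2 * v)) \<longleftrightarrow> interleaved (2 * a) (2 * b) (2 * c + 1) (4 * v)"
    using gap_position[of n t] t_free n by auto
  obtain v s where v: "v < n" "s = 1 \<or> s = -1" "\<not> (2 * v \<in> edge_ends e \<and> 2 * v \<in> edge_ends f)"
    and noncross: "\<And>g. g \<in> {e, f} \<Longrightarrow> \<not> interleaved (2 * fst (chord s g)) (2 * snd (chord s g)) (2 * c + 1) (4 * v)"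
    using escape[OF n E ef c(1)] by blast
  \<comment> \<open>The escape chord. It can meet \<open>C\<close> only at its own ends, and neither
    of these lies in \<open>C\<close>, so it stays in \<open>R\<close>.\<close>
  define T where "T = closed_segment (pt t) (pt (real (2 * v)))"
  have vC: "node (2 * v) \<notin> C"
    using common v(3) by blast
  have tC: "hemi 1 (pt t) \<notin> C"
    using x(3) in_components_subset[OF R] unfolding t by blast
  have "hemi s ` T \<subseteq> S2 - C"
  proof (intro image_subsetI DiffI)
    fix y assume y: "y \<in> T"
    have y1: "norm y \<le> 1"
      using y segment_in_disc unfolding T_def by blast
    then show "hemi s y \<in> S2"
      using v(2) by (auto intro: hemi_in_S2)
    show "hemi s y \<notin> C"
    proof
      assume yC: "hemi s y \<in> C"
      then obtain g where g: "g \<in> {e, f}" "hemi s y \<in> path_image (edge_path g)"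
        using onC by blast
      have "y = pt t \<or> y = pt (real (2 * v))"
      proof (cases "norm y = 1")
        case True
        then show ?thesis
          using segment_on_circle y unfolding T_def by blast
      next
        case False
        then have "norm y < 1"
          using y1 by simp
        then have yg: "y \<in> disc_chord s g"
          using hemi_in_edge_path v(2) g by blast
        define p q where "p = fst (chord s g)" and "q = snd (chord s g)"
        have "p < 2 * n" "q < 2 * n"
          using g E edge_wf[OF n] by (cases g; auto simp: p_def q_def)+
        moreover have "p \<noteq> q"
          using disc_chord_line[OF \<open>norm y < 1\<close> yg] by (simp add: p_def q_def)
        moreover have "\<not> interleaved (real p) (real q) t (real (2 * v))"
          using noncross[OF g(1)] c(2)[of p q v] calculation v(1) by (simp add: p_def q_def)
        ultimately show ?thesis
          using segments_meet[of y "real p" "real q" t "real (2 * v)"] yg y t_free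
          unfolding T_def disc_chord_def p_def[symmetric] q_def[symmetric] by (auto simp: doubleton_eq_iff)
      qed
      moreover have "hemi s (pt t) = hemi 1 (pt t)" "hemi s (pt (real (2 * v))) = node (2 * v)"
        by (simp_all add: node_def hemi_circle[of _ s 1])
      ultimately show False
        using yC vC tC by metis
    qed
  qed
  moreover have "connected (hemi s ` T)"
    unfolding T_def by (intro connected_continuous_image continuous_on_hemi) simp
  moreover have "hemi s (pt t) \<in> hemi s ` T" "hemi s (pt (real (2 * v))) \<in> hemi s ` T"
    by (auto simp: T_def)
  moreover have "hemi s (pt t) \<in> R"
    using x(3) by (simp add: t hemi_circle[of _ s 1])
  ultimately have "hemi s (pt (real (2 * v))) \<in> R"
    using components_maximal[OF R, of "hemi s ` T"] by blast
  then have "node (2 * v) \<in> R"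
    by (simp add: node_def hemi_circle[of _ s 1])
  then show ?thesis
    using v(1) by blast
qed

end

section \<open>Assembling the graph\<close>

lemma node_in_S2: "node c \<in> S2"
  unfolding node_def by (rule hemi_in_S2) simp_all

context weave_drawing
begin

lemma interior_no_vertex:
  assumes "e \<in> all_edges n"
  shows "node (2 * v) \<notin> arc_interior (edge_path e)"
proof -
  obtain a m b where "e = (a, m, b)"
    by (cases e)
  then show ?thesis
    using node_on_edge[OF assms, of v] edge_interior[OF assms] by auto
qed

lemma adjacent_zero:
  assumes "0 < j" "j < n"
  shows "(0, 2 * j, 2 * j) \<in> all_edges n"
  using assms unfolding all_edges_def upper_edges_def by force

end

theorem theorem23:
  fixes n :: nat
  assumes "n \<ge> 4"
  shows "\<exists>(E :: nat set) (ends :: nat \<Rightarrow> nat \<times> nat) (pos :: nat \<Rightarrow> real^3)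
           (\<gamma> :: nat \<Rightarrow> real \<Rightarrow> real^3).
           multigraph {..<n} E ends \<and> mg_connected {..<n} E ends \<and>
           card E = 8 * n - 20 \<and>
           drawing {..<n} E ends pos \<gamma> \<and>
           quasiplanar_drawing E \<gamma> \<and>
           nonhomotopic_drawing {..<n} E pos \<gamma>"
proof -
  interpret weave_drawing n
    using assms by unfold_locales
  \<comment> \<open>The edges have to be natural numbers, so the triples are enumerated by
    \<open>h\<close>.\<close>
  define E where "E = {..<card (all_edges n)}"
  obtain h where "bij_betw h {0..<card (all_edges n)} (all_edges n)"
    using ex_bij_betw_nat_finite card_all_edges(1)[OF n] by blast
  then have h: "bij_betw h E (all_edges n)"
    by (simp add: E_def atLeast0LessThan)
  define ends where "ends i = (fst (h i) div 2, snd (snd (h i)) div 2)" for i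
  define pos where "pos v = node (2 * v)" for v
  define \<gamma> where "\<gamma> i = edge_path (h i)" for i
  have hE: "h i \<in> all_edges n" if "i \<in> E" for i
    using h that by (auto simp: bij_betw_def)
  have h_inj: "h i \<noteq> h j" if "i \<in> E" "j \<in> E" "i \<noteq> j" for i j
    using h that by (auto simp: bij_betw_def inj_on_def)
  have ends_wf: "fst (ends i) < n" "snd (ends i) < n" "fst (ends i) \<noteq> snd (ends i)"
      "2 * fst (ends i) = fst (h i)" "2 * snd (ends i) = snd (snd (h i))" if "i \<in> E" for i
  proof -
    obtain a m b where abm: "h i = (a, m, b)"
      by (cases "h i")
    show "fst (ends i) < n" "snd (ends i) < n" "fst (ends i) \<noteq> snd (ends i)"
      "2 * fst (ends i) = fst (h i)" "2 * snd (ends i) = snd (snd (h i))"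
      using edge_wf[OF n hE[OF that, unfolded abm]] by (auto simp: ends_def abm)
  qed
  have "multigraph {..<n} E ends"
    using ends_wf by (auto simp: multigraph_def E_def)
  moreover have "mg_connected {..<n} E ends"
  proof -
    \<comment> \<open>The upper edges at vertex \<open>0\<close> form a spanning star.\<close>
    have adj: "(0, j) \<in> mg_adj E ends \<and> (j, 0) \<in> mg_adj E ends" if j: "0 < j" "j < n" for j
    proof -
      obtain i where "i \<in> E" "h i = (0, 2 * j, 2 * j)"
        using adjacent_zero[OF j] h unfolding bij_betw_def by (metis imageE)
      then have "i \<in> E" "ends i = (0, j)"
        by (auto simp: ends_def)
      then show ?thesis
        unfolding mg_adj_def by blast
    qed
    have "(0, j) \<in> (mg_adj E ends)\<^sup>* \<and> (j, 0) \<in> (mg_adj E ends)\<^sup>*" if "j < n" for j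
      using adj[of j] that by (cases "j = 0") auto
    then show ?thesis
      unfolding mg_connected_def by (meson lessThan_iff rtrancl_trans)
  qed
  moreover have "card E = 8 * n - 20"
    by (simp add: E_def card_all_edges[OF n])
  moreover have crosses: "crosses (h i) (h j)" if "i \<in> E" "j \<in> E" "edges_cross \<gamma> i j" for i j
    using that crossing_point_crosses[OF hE hE h_inj] unfolding edges_cross_def \<gamma>_def by blast
  then have qp: "quasiplanar_drawing E \<gamma>"
    unfolding quasiplanar_drawing_def using no_three_crossing[OF n hE hE hE] by blast
  moreover have "drawing {..<n} E ends pos \<gamma>"
    unfolding drawing_def
  proof (intro conjI ballI impI)
    show "pos ` {..<n} \<subseteq> S2"
      by (auto simp: pos_def node_in_S2)
    show "inj_on pos {..<n}"
      by (auto simp: pos_def inj_on_def)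
  next
    fix i assume i: "i \<in> E"
    show "arc (\<gamma> i)" "path_image (\<gamma> i) \<subseteq> S2"
      using arc_edge hE[OF i] edge_path_in_S2 by (auto simp: \<gamma>_def)
    show "pathstart (\<gamma> i) = pos (fst (ends i))" "pathfinish (\<gamma> i) = pos (snd (ends i))"
      using ends_wf[OF i] by (simp_all add: \<gamma>_def pos_def)
    show "arc_interior (\<gamma> i) \<inter> pos ` {..<n} = {}"
      using interior_no_vertex[OF hE[OF i]] by (auto simp: \<gamma>_def pos_def)
  next
    fix i j assume ij: "i \<in> E" "j \<in> E" "i \<noteq> j"
    show "finite (path_image (\<gamma> i) \<inter> path_image (\<gamma> j))"
      using finite_edges_Int hE h_inj ij by (simp add: \<gamma>_def)
    show "proper_crossing (\<gamma> i) (\<gamma> j) p" if "p \<in> arc_interior (\<gamma> i) \<inter> arc_interior (\<gamma> j)" for p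
      using crossing_point_proper[of "h i" "h j" p] hE h_inj ij that by (simp add: \<gamma>_def)
  next
    \<comment> \<open>Three edges through one point would cross pairwise, so quasiplanarity excludes
      triple points.\<close>
    fix i j k assume "i \<in> E" "j \<in> E" "k \<in> E" "i \<noteq> j \<and> i \<noteq> k \<and> j \<noteq> k"
    then show "arc_interior (\<gamma> i) \<inter> arc_interior (\<gamma> j) \<inter> arc_interior (\<gamma> k) = {}"
      using qp unfolding quasiplanar_drawing_def edges_cross_def by blast
  qed
  moreover have "nonhomotopic_drawing {..<n} E pos \<gamma>"
    unfolding nonhomotopic_drawing_def Let_def
  \<comment> \<open>Every region of a lens contains a vertex, so the alternative of a crossing never
    has to be chosen.\<close>
  proof (intro ballI allI impI disjI1, elim conjE)
    fix i j a b c d R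
    assume ij: "i \<in> E" "j \<in> E" and *: "0 \<le> a" "a < b" "b \<le> 1" "0 \<le> c" "c < d" "d \<le> (1::real)"
      "{pathstart (subpath a b (\<gamma> i)), pathfinish (subpath a b (\<gamma> i))}
        = {pathstart (subpath c d (\<gamma> j)), pathfinish (subpath c d (\<gamma> j))}"
      "path_image (subpath a b (\<gamma> i)) \<inter> path_image (subpath c d (\<gamma> j))
        = {pathstart (subpath a b (\<gamma> i)), pathfinish (subpath a b (\<gamma> i))}"
      "R \<in> components (S2 - (path_image (subpath a b (\<gamma> i)) \<union> path_image (subpath c d (\<gamma> j))))"
    show "\<exists>v\<in>{..<n}. pos v \<in> R"
      using lens_region_contains_vertex[OF hE[OF ij(1)] hE[OF ij(2)] *(1-6) refl refl *(7-9)[unfolded \<gamma>_def]]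
      by (auto simp: pos_def)
  qed
  ultimately show ?thesis
    by blast
qed

end
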